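(* Let $G$ be a finite simple graph with edge ideal $I(G)$, and let $M_2(I(G))=I(G)^{(2)}/I(G)^2$. With the convention $\operatorname{v}(I(H))=0$ when a graph $H$ has no edges, $$\operatorname{v}(M_2(I(G)))=\min\{3+\operatorname{v}(I(G-N_G[T]))\mid T\text{ is a triangle in }G\}.$$
   Context: Let $G$ be a simple graph on $V(G)=[n]$ with edge set $E(G)$ and $R=k[x_1,\dots,x_n]$ a standard graded polynomial ring over a field $k$. The edge ideal is $I(G)=(x_ix_j\mid\{i,j\}\in E(G))$. For a graph $H$ on a subset of vertices, $I(H)$ is its edge ideal. For $U\subseteq V(G)$, $N_G[U]$ is the closed neighborhood: $U$ together with all vertices adjacent to some vertex of $U$; $G-U$ is the induced subgraph on $V(G)\setminus U$. The $t$-th symbolic power of $I$ is $I^{(t)}=\bigcap_{P\in \operatorname{Ass}(R/I)} (I^tR_P\cap R)$. For a finitely generated graded $R$-module $M$ and $P\in\operatorname{Ass}(M)$, $\operatorname{v}_P(M)=\min\{\deg m\mid m\in M\text{ homogeneous},\ \operatorname{ann}_R(m)=P\}$, and $\operatorname{v}(M)=\min\{\operatorname{v}_P(M)\mid P\in\operatorname{Ass}(M)\}$. For a graded ideal $J$, $\operatorname{v}(J)$ means $\operatorname{v}(R/J)$. A minimum over the empty set is $\infty$ (so both sides are $\infty$ if $G$ has no triangle). *)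

theory Defs
  imports
    "HOL-Algebra.Ideal_Product"
    "HOL-Algebra.QuotRing"
    "HOL-Algebra.Module"
    "HOL-Library.Poly_Mapping"
    "HOL-Library.Extended_Nat"
begin

section \<open>Graphs\<close>

record 'v ugraph =
  vertices :: "'v set"
  edges :: "'v set set"

definition simple_graph :: "'v ugraph \<Rightarrow> bool" where
  "simple_graph G \<longleftrightarrow> finite (vertices G) \<and> (\<forall>e\<in>edges G. e \<subseteq> vertices G \<and> card e = 2)"

definition closed_nbhd :: "'v ugraph \<Rightarrow> 'v set \<Rightarrow> 'v set" where
  "closed_nbhd G U = U \<union> {v \<in> vertices G. \<exists>u\<in>U. {u, v} \<in> edges G}"

definition delete_vertices :: "'v ugraph \<Rightarrow> 'v set \<Rightarrow> 'v ugraph" where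
  "delete_vertices G U =
     \<lparr>vertices = vertices G - U, edges = {e \<in> edges G. e \<subseteq> vertices G - U}\<rparr>"

definition is_triangle :: "'v ugraph \<Rightarrow> 'v set \<Rightarrow> bool" where
  "is_triangle G T \<longleftrightarrow>
     T \<subseteq> vertices G \<and> card T = 3 \<and> (\<forall>u\<in>T. \<forall>v\<in>T. u \<noteq> v \<longrightarrow> {u, v} \<in> edges G)"

section \<open>Associated primes, subquotients, symbolic powers\<close>

definition annihilator ::
  "('r, 'a) ring_scheme \<Rightarrow> ('r, 'm, 'b) module_scheme \<Rightarrow> 'm \<Rightarrow> 'r set" where
  "annihilator R M m = {r \<in> carrier R. r \<odot>\<^bsub>M\<^esub> m = \<zero>\<^bsub>M\<^esub>}"

definition associated_primes ::
  "('r, 'a) ring_scheme \<Rightarrow> ('r, 'm, 'b) module_scheme \<Rightarrow> 'r set set" where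
  "associated_primes R M = {P. primeideal P R \<and> (\<exists>m\<in>carrier M. annihilator R M m = P)}"

text \<open>The \<open>R\<close>-module \<open>A / B\<close> for ideals \<open>B \<subseteq> A\<close> of \<open>R\<close>, as a set of cosets. The record
  type of modules contains ring multiplication and unit, which play no role in a module.\<close>

definition quotient_module ::
  "('r, 'a) ring_scheme \<Rightarrow> 'r set \<Rightarrow> 'r set \<Rightarrow> ('r, 'r set) module" where
  "quotient_module R A B =
     \<lparr>carrier = (\<lambda>a. B +>\<^bsub>R\<^esub> a) ` A, mult = undefined, one = undefined,
      zero = B, add = set_add R,
      smult = (\<lambda>r C. \<Union>x\<in>C. B +>\<^bsub>R\<^esub> (r \<otimes>\<^bsub>R\<^esub> x))\<rparr>"

text \<open>Equality of the fractions \<open>a / s\<close> and \<open>b / t\<close> in the localization of \<open>R\<close> at the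
  prime \<open>P\<close> (with \<open>s\<close> and \<open>t\<close> outside \<open>P\<close>).\<close>

definition loc_eq ::
  "('r, 'a) ring_scheme \<Rightarrow> 'r set \<Rightarrow> 'r \<times> 'r \<Rightarrow> 'r \<times> 'r \<Rightarrow> bool" where
  "loc_eq R P = (\<lambda>(a, s) (b, t). \<exists>u\<in>carrier R - P.
     u \<otimes>\<^bsub>R\<^esub> (a \<otimes>\<^bsub>R\<^esub> t \<ominus>\<^bsub>R\<^esub> b \<otimes>\<^bsub>R\<^esub> s) = \<zero>\<^bsub>R\<^esub>)"

text \<open>\<open>J R\<^sub>P \<inter> R\<close>: the elements \<open>f\<close> whose image \<open>f / 1\<close> in the localization equals some
  \<open>a / s\<close> with \<open>a \<in> J\<close> and \<open>s \<notin> P\<close>.\<close>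

definition loc_contraction :: "('r, 'a) ring_scheme \<Rightarrow> 'r set \<Rightarrow> 'r set \<Rightarrow> 'r set" where
  "loc_contraction R J P =
     {f \<in> carrier R. \<exists>a\<in>J. \<exists>s\<in>carrier R - P. loc_eq R P (f, \<one>\<^bsub>R\<^esub>) (a, s)}"

definition ideal_power :: "('r, 'a) ring_scheme \<Rightarrow> 'r set \<Rightarrow> nat \<Rightarrow> 'r set" where
  "ideal_power R I t = I [^]\<^bsub>ideals_set R\<^esub> t"

text \<open>Intersecting with \<open>carrier R\<close> only matters for \<open>I = R\<close>, which has no associated primes.\<close>

definition symbolic_power :: "('r, 'a) ring_scheme \<Rightarrow> 'r set \<Rightarrow> nat \<Rightarrow> 'r set" where
  "symbolic_power R I t = carrier R \<inter>
     (\<Inter>P\<in>associated_primes R (quotient_module R (carrier R) I).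
        loc_contraction R (ideal_power R I t) P)"

section \<open>The v-number\<close>

text \<open>A graded module is given by \<open>M\<close> together with its homogeneous components \<open>gr d \<subseteq> M\<close>.
  An element whose annihilator is prime is nonzero, hence lies in at most one component.
  The infimum of the empty set in \<^typ>\<open>enat\<close> is \<open>\<infinity>\<close>.\<close>

definition v_number_at ::
  "('r, 'a) ring_scheme \<Rightarrow> ('r, 'm, 'b) module_scheme \<Rightarrow> (nat \<Rightarrow> 'm set) \<Rightarrow> 'r set \<Rightarrow> enat" where
  "v_number_at R M gr P = Inf {enat d |d. \<exists>m\<in>gr d. annihilator R M m = P}"

definition v_number ::
  "('r, 'a) ring_scheme \<Rightarrow> ('r, 'm, 'b) module_scheme \<Rightarrow> (nat \<Rightarrow> 'm set) \<Rightarrow> enat" where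
  "v_number R M gr = (INF P\<in>associated_primes R M. v_number_at R M gr P)"

section \<open>The standard graded polynomial ring and edge ideals\<close>

text \<open>Polynomials over \<open>'k\<close> in the variables indexed by \<open>'v\<close>: finitely supported functions
  from exponent vectors to coefficients.\<close>

type_synonym ('v, 'k) mpoly = "('v \<Rightarrow>\<^sub>0 nat) \<Rightarrow>\<^sub>0 'k"

definition poly_ring :: "('v, 'k::field) mpoly ring" where
  "poly_ring = \<lparr>carrier = UNIV, mult = (*), one = 1, zero = 0, add = (+)\<rparr>"

definition indet :: "'v \<Rightarrow> ('v, 'k::field) mpoly" where
  "indet v = Poly_Mapping.single (Poly_Mapping.single v 1) 1"

definition homogeneous_component :: "nat \<Rightarrow> ('v::finite, 'k::field) mpoly set" where
  "homogeneous_component d =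
     {p. \<forall>m\<in>Poly_Mapping.keys p. (\<Sum>v\<in>UNIV. Poly_Mapping.lookup m v) = d}"

text \<open>The grading on \<open>A / B\<close> induced by the standard grading, for homogeneous ideals \<open>B \<subseteq> A\<close>.\<close>

definition quotient_grading ::
  "('v::finite, 'k::field) mpoly set \<Rightarrow> ('v, 'k) mpoly set \<Rightarrow> nat \<Rightarrow> ('v, 'k) mpoly set set" where
  "quotient_grading A B d = (\<lambda>a. B +>\<^bsub>poly_ring\<^esub> a) ` (A \<inter> homogeneous_component d)"

definition v_quotient :: "('v::finite, 'k::field) mpoly set \<Rightarrow> ('v, 'k) mpoly set \<Rightarrow> enat" where
  "v_quotient A B = v_number poly_ring (quotient_module poly_ring A B) (quotient_grading A B)"

definition v_ideal :: "('v::finite, 'k::field) mpoly set \<Rightarrow> enat" where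
  "v_ideal J = v_quotient (carrier poly_ring) J"

definition edge_ideal :: "'v ugraph \<Rightarrow> ('v, 'k::field) mpoly set" where
  "edge_ideal G = Idl\<^bsub>poly_ring\<^esub> {indet i * indet j |i j. {i, j} \<in> edges G}"

text \<open>\<open>v(I(H))\<close>, with the convention that it is \<open>0\<close> for graphs without edges. The field is
  passed as a type argument, since the graph does not determine it.\<close>

definition v_edge_ideal :: "'k::field itself \<Rightarrow> 'v::finite ugraph \<Rightarrow> enat" where
  "v_edge_ideal _ H = (if edges H = {} then 0 else v_ideal (edge_ideal H :: ('v, 'k) mpoly set))"

text \<open>\<open>v(M\<^sub>t(I))\<close> where \<open>M\<^sub>t(I)\<close> is the \<open>t\<close>-th symbolic power of \<open>I\<close> modulo \<open>I\<^sup>t\<close>.\<close>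

definition v_symbolic_defect :: "nat \<Rightarrow> ('v::finite, 'k::field) mpoly set \<Rightarrow> enat" where
  "v_symbolic_defect t I = v_quotient (symbolic_power poly_ring I t) (ideal_power poly_ring I t)"

end

theory Submission
  imports Defs
begin

text \<open>For monomial ideals \<open>B \<subseteq> A\<close>, a homogeneous element of \<open>A / B\<close> with prime annihilator can be
  replaced by one of its monomials with the same annihilator, so the v-number of \<open>A / B\<close> is the
  least degree of a monomial \<open>w \<in> A\<close> for which \<open>B : w\<close> is generated by variables. For edge ideals,
  localizing at the primes of minimal vertex covers shows that the symbolic square of \<open>I\<close> is
  generated by \<open>I\<^sup>2\<close> and the monomials \<open>x\<^sub>T\<close> of the triangles \<open>T\<close>, so \<open>w = x\<^sub>T f\<close> when
  \<open>w\<close> is outside \<open>I\<^sup>2\<close>; and \<open>I\<^sup>2 : x\<^sub>T\<close> is generated by the variables in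
  \<open>N[T]\<close> and the edge ideal of \<open>H = G - N[T]\<close>. Hence \<open>I\<^sup>2 : x\<^sub>T f\<close> is prime iff \<open>f\<close> avoids \<open>N[T]\<close>
  and \<open>I(H) : f\<close> is prime.\<close>

abbreviation lookup :: "('a \<Rightarrow>\<^sub>0 'b::zero) \<Rightarrow> 'a \<Rightarrow> 'b" where
  "lookup \<equiv> Poly_Mapping.lookup"

abbreviation keys :: "('a \<Rightarrow>\<^sub>0 'b::zero) \<Rightarrow> 'a set" where
  "keys \<equiv> Poly_Mapping.keys"

abbreviation monom :: "('v \<Rightarrow>\<^sub>0 nat) \<Rightarrow> ('v, 'k::field) mpoly" where
  "monom a \<equiv> Poly_Mapping.single a 1"

abbreviation var :: "'v \<Rightarrow> ('v \<Rightarrow>\<^sub>0 nat)" where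
  "var v \<equiv> Poly_Mapping.single v 1"

section \<open>Products and leading terms\<close>

text \<open>By cancellation, \<open>a' = a\<close> forces \<open>b' = b\<close>, so the convolution
  sum for this coefficient has only one term that can be nonzero. This is the no-cancellation
  principle behind every leading-term argument below.\<close>

lemma lookup_mult_unique:
  fixes p q :: "('a::cancel_comm_monoid_add) \<Rightarrow>\<^sub>0 'b::semiring_0"
  assumes "\<And>a' b'. a' \<in> keys p \<Longrightarrow> b' \<in> keys q \<Longrightarrow> a' + b' = a + b \<Longrightarrow> a' = a"
  shows "lookup (p * q) (a + b) = lookup p a * lookup q b"
proof -
  have "lookup p l * (\<Sum>x. lookup q x when a + b = l + x) = (lookup p a * lookup q b when l = a)" for l
  proof (cases "l = a")
    case False
    have "lookup p l = 0 \<or> (\<forall>x. (lookup q x when a + b = l + x) = 0)"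
      using assms[of l] False by (force simp: in_keys_iff when_def)
    then show ?thesis using False by auto
  qed simp
  then show ?thesis by (simp add: lookup_mult)
qed

lemma lookup_single_times [simp]:
  fixes q :: "('a::cancel_comm_monoid_add) \<Rightarrow>\<^sub>0 'b::semiring_0"
  shows "lookup (Poly_Mapping.single a c * q) (a + b) = c * lookup q b"
  by (subst lookup_mult_unique) (auto split: if_splits)

lemma keys_single_times:
  fixes q :: "('a::cancel_comm_monoid_add) \<Rightarrow>\<^sub>0 'b::semiring_no_zero_divisors"
  assumes "c \<noteq> 0"
  shows "keys (Poly_Mapping.single a c * q) = (+) a ` keys q"
proof
  show "keys (Poly_Mapping.single a c * q) \<subseteq> (+) a ` keys q"
    using keys_mult[of "Poly_Mapping.single a c" q] by (auto split: if_splits)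
  show "(+) a ` keys q \<subseteq> keys (Poly_Mapping.single a c * q)"
    using assms by (auto simp: in_keys_iff)
qed

text \<open>Since \<open>'v\<close> carries no order, this embedding into the lexicographically ordered exponent
  vectors over \<^typ>\<open>nat\<close> serves as the monomial order.\<close>

definition lex_code :: "('v::finite \<Rightarrow>\<^sub>0 nat) \<Rightarrow> (nat \<Rightarrow>\<^sub>0 nat)" where
  "lex_code a = (\<Sum>v\<in>UNIV. Poly_Mapping.single (to_nat v) (lookup a v))"

lemma lex_code_add: "lex_code (a + b) = lex_code a + lex_code b"
  by (simp add: lex_code_def lookup_add single_add sum.distrib)

lemma lex_code_inj:
  fixes a b :: "'v::finite \<Rightarrow>\<^sub>0 nat"
  shows "lex_code a = lex_code b \<Longrightarrow> a = b"
proof (rule poly_mapping_eqI)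
  fix v :: 'v
  assume *: "lex_code a = lex_code b"
  have "lookup (lex_code c) (to_nat v) = lookup c v" for c :: "'v \<Rightarrow>\<^sub>0 nat"
    by (simp add: lex_code_def lookup_sum lookup_single when_def)
  with * show "lookup a v = lookup b v" by metis
qed

lemma exists_least_key:
  fixes f :: "'a \<Rightarrow> 'b::linorder"
  assumes "finite S" "S \<noteq> {}"
  obtains a where "a \<in> S" "\<And>b. b \<in> S \<Longrightarrow> f a \<le> f b"
  using assms by (metis arg_min_if_finite(1) arg_min_least)

text \<open>The order on codes is compatible with addition, so a sum of two least exponents arises
  in no other way. This supplies the uniqueness hypothesis of \<open>lookup_mult_unique\<close> for
  least terms.\<close>

lemma lex_code_least_sum:
  assumes "lex_code a \<le> lex_code a'" "lex_code b \<le> lex_code b'" "a' + b' = a + b"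
  shows "a' = a \<and> b' = b"
proof -
  have "lex_code a' + lex_code b' = lex_code a + lex_code b"
    using assms(3) by (metis lex_code_add)
  then have "lex_code a' = lex_code a"
    using assms(1,2) by (metis add_le_cancel_left add_le_cancel_right add_mono antisym)
  then have "a' = a" by (rule lex_code_inj)
  then show ?thesis using assms(3) by simp
qed

section \<open>The polynomial ring and its monomial ideals\<close>

lemma poly_ring_simps [simp]:
  "carrier poly_ring = UNIV" "x \<otimes>\<^bsub>poly_ring\<^esub> y = x * y" "x \<oplus>\<^bsub>poly_ring\<^esub> y = x + y"
  "\<one>\<^bsub>poly_ring\<^esub> = 1" "\<zero>\<^bsub>poly_ring\<^esub> = 0"
  by (simp_all add: poly_ring_def)

lemma cring_poly_ring: "cring (poly_ring :: ('v, 'k::field) mpoly ring)"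
proof (rule cringI)
  have "\<exists>y. y + x = 0" for x :: "('v, 'k) mpoly"
    by (rule exI[of _ "- x"]) simp
  then show "abelian_group (poly_ring :: ('v, 'k) mpoly ring)"
    by (intro abelian_groupI) (auto simp: add.assoc intro: add.commute)
  show "comm_monoid (poly_ring :: ('v, 'k) mpoly ring)"
    by (rule comm_monoidI) (auto simp: mult.assoc mult.commute)
qed (simp add: distrib_right)

lemma a_inv_poly_ring [simp]: "\<ominus>\<^bsub>poly_ring\<^esub> x = - (x :: ('v, 'k::field) mpoly)"
proof -
  interpret cring "poly_ring :: ('v, 'k) mpoly ring" by (rule cring_poly_ring)
  show ?thesis by (rule minus_equality) auto
qed

lemma a_minus_poly_ring [simp]: "x \<ominus>\<^bsub>poly_ring\<^esub> y = x - (y :: ('v, 'k::field) mpoly)"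
  by (simp add: a_minus_def)

lemma ideal_poly_ringI:
  fixes J :: "('v, 'k::field) mpoly set"
  assumes "0 \<in> J" "\<And>x y. x \<in> J \<Longrightarrow> y \<in> J \<Longrightarrow> x + y \<in> J" "\<And>x r. x \<in> J \<Longrightarrow> r * x \<in> J"
  shows "ideal J poly_ring"
proof -
  interpret cring "poly_ring :: ('v, 'k) mpoly ring" by (rule cring_poly_ring)
  \<comment> \<open>Negation is multiplication by -1, so absorption yields closure under additive
    inverses.\<close>
  have "inv\<^bsub>add_monoid poly_ring\<^esub> x \<in> J" if "x \<in> J" for x
    using assms(3)[OF that, of "-1"] a_inv_poly_ring[of x] by (simp add: a_inv_def)
  then have "subgroup J (add_monoid poly_ring)"
    using assms(1,2) by (simp add: subgroup_def)
  then show ?thesis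
    by (intro idealI) (use assms in \<open>auto simp: mult.commute ring_axioms\<close>)
qed

lemma ideal_poly_ringD:
  fixes J :: "('v, 'k::field) mpoly set"
  assumes "ideal J poly_ring"
  shows "0 \<in> J" "x \<in> J \<Longrightarrow> y \<in> J \<Longrightarrow> x + y \<in> J" "x \<in> J \<Longrightarrow> y \<in> J \<Longrightarrow> x - y \<in> J"
    "x \<in> J \<Longrightarrow> r * x \<in> J" "x \<in> J \<Longrightarrow> x * r \<in> J"
proof -
  interpret ideal J "poly_ring :: ('v, 'k) mpoly ring" by (rule assms)
  show "0 \<in> J" using additive_subgroup.zero_closed[OF ideal.axioms(1)[OF assms]] by simp
  show *: "x + y \<in> J" if "x \<in> J" "y \<in> J" for x y 
    using additive_subgroup.a_closed[OF ideal.axioms(1)[OF assms] that] by simp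
  show **: "r * x \<in> J" if "x \<in> J" for r x using I_l_closed[OF that] by simp
  show "x * r \<in> J" if "x \<in> J" using **[OF that] by (simp add: mult.commute)
  show "x - y \<in> J" if "x \<in> J" "y \<in> J"
    using *[OF that(1) **[OF that(2), of "-1"]] by simp
qed

lemma primeideal_poly_ring_iff:
  fixes P :: "('v, 'k::field) mpoly set"
  shows "primeideal P poly_ring \<longleftrightarrow>
    ideal P poly_ring \<and> P \<noteq> UNIV \<and> (\<forall>x y. x * y \<in> P \<longrightarrow> x \<in> P \<or> y \<in> P)"
  using cring_poly_ring
  by (auto simp: primeideal_def primeideal_axioms_def)

section \<open>Monomial ideals encoded by sets of exponents\<close>

definition monomial_ideal :: "('v \<Rightarrow>\<^sub>0 nat) set \<Rightarrow> ('v, 'k::field) mpoly set" where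
  "monomial_ideal Q = {p. keys p \<subseteq> Q}"

text \<open>The counterpart of an ideal on the level of exponents: a set of monomials closed under
  taking multiples.\<close>

definition absorbing :: "('a::plus) set \<Rightarrow> bool" where
  "absorbing Q \<longleftrightarrow> (\<forall>a\<in>Q. \<forall>b. a + b \<in> Q)"

lemma absorbingD: "absorbing Q \<Longrightarrow> a \<in> Q \<Longrightarrow> a + b \<in> Q"
  by (simp add: absorbing_def)

lemma absorbingD': "absorbing Q \<Longrightarrow> a \<in> Q \<Longrightarrow> b + a \<in> (Q :: 'a::ab_semigroup_add set)"
  by (metis absorbing_def add.commute)

lemma ideal_monomial_ideal:
  assumes "absorbing Q"
  shows "ideal (monomial_ideal Q :: ('v, 'k::field) mpoly set) poly_ring"
proof (rule ideal_poly_ringI)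
  fix x y r :: "('v, 'k) mpoly"
  show "x + y \<in> monomial_ideal Q" if "x \<in> monomial_ideal Q" "y \<in> monomial_ideal Q"
    using that Poly_Mapping.keys_add[of x y] by (auto simp: monomial_ideal_def)
  show "r * x \<in> monomial_ideal Q" if "x \<in> monomial_ideal Q"
    using that keys_mult[of r x] absorbingD'[OF assms] by (force simp: monomial_ideal_def)
qed (simp add: monomial_ideal_def)

lemma monom_in_monomial_ideal [simp]:
  "(monom a :: ('v, 'k::field) mpoly) \<in> monomial_ideal Q \<longleftrightarrow> a \<in> Q"
  by (simp add: monomial_ideal_def)

lemma keys_minus_term: "keys (p - Poly_Mapping.single a (lookup p a)) = keys p - {a}"
  for p :: "'a \<Rightarrow>\<^sub>0 'b::ab_group_add"
proof -
  have "lookup (p - Poly_Mapping.single a (lookup p a)) b = (lookup p b when b \<noteq> a)" for b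
    by (auto simp: lookup_minus lookup_single when_def)
  then show ?thesis by (auto simp: in_keys_iff)
qed

lemma card_keys_minus_term:
  fixes p :: "'a \<Rightarrow>\<^sub>0 'b::ab_group_add"
  shows "a \<in> keys p \<Longrightarrow> card (keys (p - Poly_Mapping.single a (lookup p a))) < card (keys p)"
  unfolding keys_minus_term by (intro card_Diff1_less finite_keys)

text \<open>Induction on the number of terms: a term is a constant times its monomial, so it lies in
  \<open>J\<close> and can be split off.\<close>

lemma in_ideal_if_monoms:
  fixes p :: "('v, 'k::field) mpoly"
  assumes "ideal J poly_ring" "\<And>a. a \<in> keys p \<Longrightarrow> monom a \<in> J"
  shows "p \<in> J"
  using assms(2)
proof (induction "card (keys p)" arbitrary: p rule: less_induct)
  case less
  show ?case
  proof (cases "p = 0")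
    case False
    then obtain a where a: "a \<in> keys p" by fastforce
    define t where "t = Poly_Mapping.single a (lookup p a)"
    have "p - t \<in> J"
      unfolding t_def
      by (rule less.hyps[OF card_keys_minus_term[OF a]]) (simp add: less.prems keys_minus_term)
    moreover have "t = Poly_Mapping.single 0 (lookup p a) * monom a"
      by (simp add: t_def mult_single)
    then have "t \<in> J" using less.prems[OF a] ideal_poly_ringD(4)[OF assms(1)] by simp
    ultimately have "(p - t) + t \<in> J" by (rule ideal_poly_ringD(2)[OF assms(1)])
    then show ?thesis by simp
  qed (simp add: ideal_poly_ringD(1)[OF assms(1)])
qed

lemma monomial_ideal_subset:
  fixes J :: "('v, 'k::field) mpoly set"
  assumes "ideal J poly_ring" "\<And>a. a \<in> Q \<Longrightarrow> monom a \<in> J"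
  shows "monomial_ideal Q \<subseteq> J"
proof
  fix p :: "('v, 'k) mpoly"
  assume p: "p \<in> monomial_ideal Q"
  show "p \<in> J"
    by (rule in_ideal_if_monoms[OF assms(1) assms(2)]) (use p in \<open>auto simp: monomial_ideal_def\<close>)
qed

lemma genideal_monoms:
  fixes S :: "('v \<Rightarrow>\<^sub>0 nat) set"
  shows "Idl\<^bsub>poly_ring\<^esub> (monom ` S :: ('v, 'k::field) mpoly set) =
    monomial_ideal {s + t |s t. s \<in> S}" (is "_ = monomial_ideal ?Q")
proof -
  interpret cring "poly_ring :: ('v, 'k) mpoly ring" by (rule cring_poly_ring)
  have abs: "absorbing ?Q" by (force simp: absorbing_def add.assoc)
  have 1: "ideal (Idl\<^bsub>poly_ring\<^esub> (monom ` S :: ('v, 'k) mpoly set)) poly_ring"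
    by (rule genideal_ideal) simp
  show ?thesis
  proof
    have "monom s \<in> (monomial_ideal ?Q :: ('v, 'k) mpoly set)" if "s \<in> S" for s
      using that by (force intro: exI[of _ 0])
    then show "Idl\<^bsub>poly_ring\<^esub> (monom ` S) \<subseteq> (monomial_ideal ?Q :: ('v, 'k) mpoly set)"
      by (intro genideal_minimal ideal_monomial_ideal abs) auto
    have "monom (s + t) \<in> Idl\<^bsub>poly_ring\<^esub> (monom ` S :: ('v, 'k) mpoly set)" if "s \<in> S" for s t
    proof -
      have "monom s \<in> Idl\<^bsub>poly_ring\<^esub> (monom ` S :: ('v, 'k) mpoly set)"
        using genideal_self[of "monom ` S"] that by auto
      from ideal_poly_ringD(5)[OF 1 this, of "monom t"] show ?thesis
        by (simp add: mult_single)
    qed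
    then have "monom c \<in> Idl\<^bsub>poly_ring\<^esub> (monom ` S :: ('v, 'k) mpoly set)" if "c \<in> ?Q" for c
      using that by blast
    then show "monomial_ideal ?Q \<subseteq> Idl\<^bsub>poly_ring\<^esub> (monom ` S :: ('v, 'k) mpoly set)"
      by (rule monomial_ideal_subset[OF 1])
  qed
qed

lemma ideal_power_2_monomial_ideal:
  fixes Q :: "('v \<Rightarrow>\<^sub>0 nat) set"
  assumes "absorbing Q"
  shows "ideal_power poly_ring (monomial_ideal Q :: ('v, 'k::field) mpoly set) 2 =
    monomial_ideal {a + b |a b. a \<in> Q \<and> b \<in> Q}" (is "_ = monomial_ideal ?Q2")
proof -
  interpret cring "poly_ring :: ('v, 'k) mpoly ring" by (rule cring_poly_ring)
  let ?I = "monomial_ideal Q :: ('v, 'k) mpoly set"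
  have id: "ideal ?I poly_ring" by (rule ideal_monomial_ideal[OF assms])
  have abs: "absorbing ?Q2"
    unfolding absorbing_def
  proof (intro ballI allI)
    fix c d assume "c \<in> ?Q2"
    then obtain a b where "c = a + b" "a \<in> Q" "b \<in> Q" by blast
    then have "c + d = a + (b + d) \<and> a \<in> Q \<and> b + d \<in> Q"
      using absorbingD[OF assms] by (simp add: add.assoc)
    then show "c + d \<in> ?Q2" by blast
  qed
  \<comment> \<open>The power taken in the monoid of ideals unfolds to a product that starts with
    the unit ideal, which has to be cancelled.\<close>
  have "ideal_power poly_ring ?I 2 = ideal_prod poly_ring ?I ?I"
    using ideal_prod_one[OF id] ideal_prod_commute[OF id oneideal] by (simp add: ideal_power_def ideals_set_def nat_pow_def
        numeral_2_eq_2 del: poly_ring_simps)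
  also have "\<dots> = monomial_ideal ?Q2"
  proof
    show "ideal_prod poly_ring ?I ?I \<subseteq> monomial_ideal ?Q2"
    proof
      fix x assume "x \<in> ideal_prod poly_ring ?I ?I"
      then show "x \<in> monomial_ideal ?Q2"
      proof induction
        case (prod i j)
        have "keys (i * j) \<subseteq> {a + b |a b. a \<in> keys i \<and> b \<in> keys j}" by (rule keys_mult)
        also have "\<dots> \<subseteq> ?Q2" using prod unfolding monomial_ideal_def by blast
        finally show ?case by (simp add: monomial_ideal_def)
      next
        case (sum s t)
        then show ?case using ideal_poly_ringD(2)[OF ideal_monomial_ideal[OF abs]] by simp
      qed
    qed
    have "monom (a + b) \<in> ideal_prod poly_ring ?I ?I" if "a \<in> Q" "b \<in> Q" for a b
      using that ideal_prod.prod[of "monom a" ?I "monom b" ?I poly_ring]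
      by (simp add: mult_single)
    then have "monom c \<in> ideal_prod poly_ring ?I ?I" if "c \<in> ?Q2" for c
      using that by blast
    then show "monomial_ideal ?Q2 \<subseteq> ideal_prod poly_ring ?I ?I"
      by (rule monomial_ideal_subset[OF ideal_prod_is_ideal[OF id id]])
  qed
  finally show ?thesis .
qed

section \<open>Prime annihilators\<close>

text \<open>For \<open>C = UNIV\<close> this is the total degree. A monomial lies in the n-th power
  of the prime generated by the variables in \<open>C\<close> iff this number is at least n.\<close>

definition degree_in :: "'v set \<Rightarrow> ('v \<Rightarrow>\<^sub>0 nat) \<Rightarrow> nat" where
  "degree_in C a = (\<Sum>v\<in>C. lookup a v)"

lemma degree_in_add: "degree_in C (a + b) = degree_in C a + degree_in C b"
  by (simp add: degree_in_def lookup_add sum.distrib)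

lemma degree_in_eq_0_iff: "degree_in C a = 0 \<longleftrightarrow> (\<forall>v\<in>C. lookup a v = 0)" for C :: "'v::finite set"
  by (simp add: degree_in_def)

lemma degree_in_pos_iff: "0 < degree_in C a \<longleftrightarrow> (\<exists>v\<in>C. 0 < lookup a v)" for C :: "'v::finite set"
  by (simp add: degree_in_eq_0_iff del: neq0_conv flip: neq0_conv)

lemma degree_in_mono: "C \<subseteq> D \<Longrightarrow> degree_in C a \<le> degree_in D a" for C D :: "'v::finite set"
  by (simp add: degree_in_def sum_mono2)

lemma var_factor:
  assumes "0 < lookup a v"
  obtains b where "a = var v + b"
proof
  show "a = var v + (a - var v)"
    using assms by (intro poly_mapping_eqI) (auto simp: lookup_add lookup_minus lookup_single when_def)
qed

text \<open>Among the keys with the least value of \<open>f\<close>, the tie is broken by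
  \<open>lex_code\<close>. This selects one key from each factor, and the product of the two
  selected terms cannot cancel.\<close>

lemma exists_least_degree_product_key:
  fixes p q :: "('v::finite, 'k::field) mpoly" and f :: "('v \<Rightarrow>\<^sub>0 nat) \<Rightarrow> nat"
  assumes f: "\<And>a b. f (a + b) = f a + f b" and "p \<noteq> 0" "q \<noteq> 0"
  obtains a b where "a \<in> keys p" "b \<in> keys q" "a + b \<in> keys (p * q)"
    "\<And>a'. a' \<in> keys p \<Longrightarrow> f a \<le> f a'" "\<And>b'. b' \<in> keys q \<Longrightarrow> f b \<le> f b'"
proof -
  have least: "\<exists>a\<in>keys r. (\<forall>a'\<in>keys r. f a \<le> f a' \<and> (f a' = f a \<longrightarrow> lex_code a \<le> lex_code a'))"
    if r: "r \<noteq> 0" for r :: "('v, 'k) mpoly"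
  proof -
    obtain a0 where a0: "a0 \<in> keys r" "\<And>a'. a' \<in> keys r \<Longrightarrow> f a0 \<le> f a'"
      by (rule exists_least_key[of "keys r" f]) (use r in auto)
    obtain a where a: "a \<in> {a \<in> keys r. f a = f a0}"
      "\<And>a'. a' \<in> {a \<in> keys r. f a = f a0} \<Longrightarrow> lex_code a \<le> lex_code a'"
      by (rule exists_least_key[of "{a \<in> keys r. f a = f a0}" lex_code]) (use a0 in auto)
    then show ?thesis using a0 by (intro bexI[of _ a]) auto
  qed
  from least[OF assms(2)] obtain a where a: "a \<in> keys p"
    "\<And>a'. a' \<in> keys p \<Longrightarrow> f a \<le> f a'" "\<And>a'. a' \<in> keys p \<Longrightarrow> f a' = f a \<Longrightarrow> lex_code a \<le> lex_code a'"
    by blast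
  from least[OF assms(3)] obtain b where b: "b \<in> keys q"
    "\<And>a'. a' \<in> keys q \<Longrightarrow> f b \<le> f a'" "\<And>a'. a' \<in> keys q \<Longrightarrow> f a' = f b \<Longrightarrow> lex_code b \<le> lex_code a'"
    by blast
  have "lookup (p * q) (a + b) = lookup p a * lookup q b"
  proof (rule lookup_mult_unique)
    fix a' b' assume *: "a' \<in> keys p" "b' \<in> keys q" "a' + b' = a + b"
    then have "f a' + f b' = f a + f b" by (metis f)
    with a(2)[OF *(1)] b(2)[OF *(2)] have "f a' = f a" "f b' = f b" by auto
    with a(3)[OF *(1)] b(3)[OF *(2)] *(3) show "a' = a"
      using lex_code_least_sum[of a a' b b'] by simp
  qed
  then have "a + b \<in> keys (p * q)"
    using a(1) b(1) by (simp add: in_keys_iff)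
  with that[OF a(1) b(1)] a(2) b(2) show thesis by blast
qed

section \<open>Monomial primes are the ideals generated by variables\<close>

lemma absorbing_degree_in: "absorbing {a. n \<le> degree_in C a}"
  by (simp add: absorbing_def degree_in_add)

text \<open>If both factors have a term free of the variables in \<open>C\<close>, then the
  uncancelled term of least degree in the product is free of them as well.\<close>

lemma primeideal_degree_in_pos:
  fixes C :: "'v::finite set"
  shows "primeideal (monomial_ideal {a. 0 < degree_in C a} :: ('v, 'k::field) mpoly set) poly_ring"
    (is "primeideal ?P _")
  unfolding primeideal_poly_ring_iff
proof (intro conjI allI impI)
  show "ideal ?P poly_ring"
    using absorbing_degree_in[of 1 C] by (intro ideal_monomial_ideal) (simp add: Suc_le_eq)
  have "(1 :: ('v, 'k) mpoly) \<notin> ?P" by (simp add: monomial_ideal_def degree_in_def)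
  then show "?P \<noteq> UNIV" by blast
  fix x y :: "('v, 'k) mpoly" assume xy: "x * y \<in> ?P"
  show "x \<in> ?P \<or> y \<in> ?P"
  proof (rule ccontr)
    assume "\<not> ?thesis"
    then obtain a b where ab: "a \<in> keys x" "degree_in C a = 0" "b \<in> keys y" "degree_in C b = 0"
      by (auto simp: monomial_ideal_def subset_iff)
    then have "x \<noteq> 0" "y \<noteq> 0" by auto
    then obtain a' b' where *: "a' + b' \<in> keys (x * y)"
      "\<And>a. a \<in> keys x \<Longrightarrow> degree_in C a' \<le> degree_in C a"
      "\<And>b. b \<in> keys y \<Longrightarrow> degree_in C b' \<le> degree_in C b"
      using exists_least_degree_product_key[of "degree_in C" x y, OF degree_in_add] by metis
    then have "degree_in C (a' + b') = 0"
      using ab *(2)[OF ab(1)] *(3)[OF ab(3)] by (simp add: degree_in_add)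
    with *(1) xy show False by (auto simp: monomial_ideal_def)
  qed
qed

text \<open>Splitting a variable off a monomial of the ideal, primality puts the variable or the
  cofactor of smaller degree into the ideal. The recursion cannot reach the monomial 1, as the ideal
  is proper.\<close>

lemma prime_monomial_idealD:
  fixes Q :: "('v::finite \<Rightarrow>\<^sub>0 nat) set"
  assumes Q: "absorbing Q"
    and prime: "primeideal (monomial_ideal Q :: ('v, 'k::field) mpoly set) poly_ring"
  shows "Q = {a. 0 < degree_in {v. var v \<in> Q} a}"
proof (intro subset_antisym subsetI)
  fix a assume "a \<in> {a. 0 < degree_in {v. var v \<in> Q} a}"
  then obtain v where "var v \<in> Q" "0 < lookup a v" by (auto simp: degree_in_pos_iff)
  then show "a \<in> Q" using absorbingD[OF Q] by (metis var_factor)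
next
  fix a assume "a \<in> Q"
  then show "a \<in> {a. 0 < degree_in {v. var v \<in> Q} a}"
  proof (induction "degree_in UNIV a" arbitrary: a rule: less_induct)
    case less
    let ?P = "monomial_ideal Q :: ('v, 'k) mpoly set"
    have "ideal ?P poly_ring" "?P \<noteq> UNIV"
      and P: "\<And>x y. x * y \<in> ?P \<Longrightarrow> x \<in> ?P \<or> y \<in> ?P"
      using prime by (auto simp: primeideal_poly_ring_iff)
    show ?case
    proof (cases "a = 0")
      case True
      then have "1 \<in> ?P" using less.prems by (simp add: monomial_ideal_def)
      then have "r \<in> ?P" for r
        using ideal_poly_ringD(4)[OF \<open>ideal ?P poly_ring\<close>, of 1 r] by simp
      with \<open>?P \<noteq> UNIV\<close> show ?thesis by blast
    next
      case False
      then obtain v where v: "0 < lookup a v"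
        by (metis gr0I lookup_zero poly_mapping_eqI)
      then obtain b where b: "a = var v + b" by (rule var_factor)
      have "monom (var v) * monom b \<in> ?P" using less.prems b by (simp add: mult_single)
      from P[OF this] consider "var v \<in> Q" | "b \<in> Q" by auto
      then show ?thesis
      proof cases
        case 1
        with v show ?thesis by (auto simp: degree_in_pos_iff)
      next
        case 2
        have "degree_in UNIV (var v) > 0" by (auto simp: degree_in_pos_iff intro: exI[of _ v])
        then have "degree_in UNIV b < degree_in UNIV a" by (simp add: b degree_in_add)
        from less.hyps[OF this 2] show ?thesis by (simp add: b degree_in_add)
      qed
    qed
  qed
qed

text \<open>The least terms of \<open>p\<close> and \<open>m\<close> multiply to an uncancelled term
  of \<open>p * m\<close>, so \<open>monom a\<close> carries the least term of \<open>m\<close> into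
  the ideal. Without that term, \<open>monom a * m\<close> has fewer terms than \<open>m\<close>,
  and induction on the number of terms applies.\<close>

lemma power_of_least_monom_annihilates:
  fixes p m :: "('v::finite, 'k::field) mpoly"
  assumes Q: "absorbing Q" and a: "a \<in> keys p" "\<And>a'. a' \<in> keys p \<Longrightarrow> lex_code a \<le> lex_code a'"
    and "p * m \<in> monomial_ideal Q"
  shows "\<exists>n. monom a ^ n * m \<in> monomial_ideal Q"
  using assms(4)
proof (induction "card (keys m)" arbitrary: m rule: less_induct)
  case less
  note I = ideal_poly_ringD[OF ideal_monomial_ideal[OF Q]]
  show ?case
  proof (cases "m = 0")
    case True
    then show ?thesis by (simp add: I(1))
  next
    case False
    then obtain b where b: "b \<in> keys m" "\<And>b'. b' \<in> keys m \<Longrightarrow> lex_code b \<le> lex_code b'"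
      by (metis exists_least_key finite_keys keys_eq_empty)
    have "lookup (p * m) (a + b) = lookup p a * lookup m b"
      by (rule lookup_mult_unique) (use lex_code_least_sum a(2) b(2) in blast)
    then have "a + b \<in> keys (p * m)" using a(1) b(1) by (simp add: in_keys_iff)
    then have ab: "a + b \<in> Q" using less.prems by (auto simp: monomial_ideal_def)
    define t where "t = Poly_Mapping.single b (lookup m b)"
    have "monom a * t = Poly_Mapping.single (a + b) (lookup m b)"
      by (simp add: t_def mult_single)
    then have at: "monom a * t \<in> monomial_ideal Q"
      using ab by (simp add: monomial_ideal_def)
    \<comment> \<open>The shorter polynomial \<open>monom a * (m - t)\<close> is still annihilated
      by \<open>p\<close> modulo the ideal.\<close>
    have "p * (monom a * (m - t)) = monom a * (p * m) - p * (monom a * t)"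
      by (simp add: algebra_simps)
    then have "p * (monom a * (m - t)) \<in> monomial_ideal Q"
      using I(3)[OF I(4)[OF less.prems] I(4)[OF at]] by simp
    moreover have "card (keys (monom a * (m - t))) < card (keys m)"
      using card_keys_minus_term[OF b(1)]
      by (simp add: keys_single_times card_image t_def)
    ultimately obtain n where n: "monom a ^ n * (monom a * (m - t)) \<in> monomial_ideal Q"
      using less.hyps by blast
    have "monom a ^ Suc n * m = monom a ^ n * (monom a * (m - t)) + monom a ^ n * (monom a * t)"
      by (simp add: algebra_simps)
    then show ?thesis using I(2)[OF n I(4)[OF at]] by metis
  qed
qed

text \<open>Associated primes of monomial ideals are monomial: the powers of the least term of an
  annihilating element annihilate as well, and primality removes the exponent.\<close>

lemma monoms_in_prime_colon:
  fixes m p :: "('v::finite, 'k::field) mpoly"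
  assumes Q: "absorbing Q"
    and prime: "primeideal {r. r * m \<in> monomial_ideal Q} poly_ring"
    and "p * m \<in> monomial_ideal Q" "a \<in> keys p"
  shows "monom a * m \<in> monomial_ideal Q"
  using assms(3,4)
proof (induction "card (keys p)" arbitrary: p rule: less_induct)
  case less
  note I = ideal_poly_ringD[OF ideal_monomial_ideal[OF Q]]
  have P: "\<And>x y. x * y * m \<in> monomial_ideal Q \<Longrightarrow> x * m \<in> monomial_ideal Q \<or> y * m \<in> monomial_ideal Q"
    and "{r. r * m \<in> monomial_ideal Q} \<noteq> UNIV"
    using prime unfolding primeideal_poly_ring_iff by auto
  then have m: "m \<notin> monomial_ideal Q" using I(4) by blast
  from less.prems obtain c where c: "c \<in> keys p" "\<And>c'. c' \<in> keys p \<Longrightarrow> lex_code c \<le> lex_code c'"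
    by (metis exists_least_key finite_keys empty_iff)
  obtain n where "monom c ^ n * m \<in> monomial_ideal Q"
    using power_of_least_monom_annihilates[OF Q c less.prems(1)] by blast
  then have cm: "monom c * m \<in> monomial_ideal Q"
  proof (induction n)
    case (Suc n)
    then show ?case using P[of "monom c" "monom c ^ n"] by auto
  qed (use m in simp)
  show ?case
  proof (cases "a = c")
    case False
    define t where "t = Poly_Mapping.single c (lookup p c)"
    have "t = Poly_Mapping.single 0 (lookup p c) * monom c" by (simp add: t_def mult_single)
    then have "t * m \<in> monomial_ideal Q" using I(4)[OF cm] by (simp add: mult.assoc)
    then have "(p - t) * m \<in> monomial_ideal Q"
      using I(3)[OF less.prems(1)] by (simp add: left_diff_distrib)
    then show ?thesis
      using less.hyps[OF card_keys_minus_term[OF c(1)]] False less.prems(2)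
      by (simp add: t_def keys_minus_term)
  qed (use cm in simp)
qed

text \<open>The prime colon ideal of \<open>m\<close> is contained in the colon ideal of every term
  of \<open>m\<close>. If all these inclusions were strict, each term would be killed by a monomial
  outside the prime; the product of these monomials would kill \<open>m\<close> and still be outside
  the prime.\<close>

lemma prime_colon_eq_colon_monom:
  fixes m :: "('v::finite, 'k::field) mpoly"
  assumes Q: "absorbing Q"
    and prime: "primeideal {r. r * m \<in> monomial_ideal Q} poly_ring"
  obtains w where "w \<in> keys m" "{r. r * m \<in> monomial_ideal Q} = monomial_ideal {a. a + w \<in> Q}"
proof (rule ccontr)
  let ?P = "{r. r * m \<in> monomial_ideal Q}"
  assume "\<not> thesis"
  then have neg: "\<And>w. w \<in> keys m \<Longrightarrow> ?P \<noteq> monomial_ideal {a. a + w \<in> Q}"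
    using that by blast
  have id: "ideal ?P poly_ring" and "?P \<noteq> UNIV" and P: "\<And>x y. x * y \<in> ?P \<Longrightarrow> x \<in> ?P \<or> y \<in> ?P"
    using prime unfolding primeideal_poly_ring_iff by blast+
  have monom_iff: "monom a * m \<in> monomial_ideal Q \<longleftrightarrow> (\<forall>w\<in>keys m. a + w \<in> Q)" for a
    by (auto simp: monomial_ideal_def keys_single_times)
  have ex: "\<exists>a. a + w \<in> Q \<and> monom a \<notin> ?P" if w: "w \<in> keys m" for w
  proof (rule ccontr)
    assume "\<not> ?thesis"
    then have "monomial_ideal {a. a + w \<in> Q} \<subseteq> ?P"
      by (intro monomial_ideal_subset[OF id]) auto
    moreover have "?P \<subseteq> monomial_ideal {a. a + w \<in> Q}"
    proof
      fix p assume "p \<in> ?P"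
      then have "monom a * m \<in> monomial_ideal Q" if "a \<in> keys p" for a
        using monoms_in_prime_colon[OF Q prime] that by blast
      then show "p \<in> monomial_ideal {a. a + w \<in> Q}"
        using w unfolding monom_iff by (auto simp: monomial_ideal_def)
    qed
    ultimately show False using neg[OF w] by blast
  qed
  \<comment> \<open>The witnesses of \<open>ex\<close> are multiplied together one key at a time;
    primality keeps each product outside \<open>?P\<close>.\<close>
  have "\<exists>a. (\<forall>w\<in>W. a + w \<in> Q) \<and> monom a \<notin> ?P" if "finite W" "W \<subseteq> keys m" for W
    using that
  proof (induction W)
    case empty
    have "1 \<notin> ?P" using \<open>?P \<noteq> UNIV\<close> ideal_poly_ringD(4)[OF id, of 1] by auto
    then show ?case by (intro exI[of _ 0]) simp
  next
    case (insert w W)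
    then obtain a where a: "\<forall>w\<in>W. a + w \<in> Q" "monom a \<notin> ?P" by auto
    obtain b where b: "b + w \<in> Q" "monom b \<notin> ?P" using ex[of w] insert.prems by auto
    have "monom (a + b) \<notin> ?P" using P[of "monom a" "monom b"] a(2) b(2) by (auto simp: mult_single)
    moreover have "a + b + w \<in> Q" using absorbingD'[OF Q b(1), of a] by (simp add: add.assoc)
    moreover have "a + b + w' \<in> Q" if "w' \<in> W" for w'
      using absorbingD'[OF Q a(1)[rule_format, OF that], of b] by (simp add: ac_simps)
    ultimately show ?case by blast
  qed
  from this[OF finite_keys order_refl] show False
    using monom_iff by blast
qed

section \<open>The v-number of a monomial subquotient\<close>

lemma in_coset_iff: "y \<in> B +>\<^bsub>poly_ring\<^esub> a \<longleftrightarrow> y - a \<in> (B :: ('v, 'k::field) mpoly set)"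
  unfolding a_r_coset_def' by (force intro: bexI[of _ "y - a"])

text \<open>Scalar multiplication on cosets is a union over all representatives. As \<open>B\<close>
  is an ideal, they all give the same coset, which turns the annihilator into a colon ideal.\<close>

lemma annihilator_coset:
  fixes B :: "('v, 'k::field) mpoly set"
  assumes "ideal B poly_ring"
  shows "annihilator poly_ring (quotient_module poly_ring A B) (B +>\<^bsub>poly_ring\<^esub> f) = {r. r * f \<in> B}"
proof -
  note I = ideal_poly_ringD[OF assms]
  have "(\<Union>x\<in>B +>\<^bsub>poly_ring\<^esub> f. B +>\<^bsub>poly_ring\<^esub> (r * x)) = B +>\<^bsub>poly_ring\<^esub> (r * f)" (is "?L = ?R") for r
  proof (intro subset_antisym subsetI)
    fix y assume "y \<in> ?L"
    then obtain x where "x - f \<in> B" "y - r * x \<in> B" by (auto simp: in_coset_iff)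
    then have "(y - r * x) + r * (x - f) \<in> B" by (intro I(2,4))
    then show "y \<in> ?R" by (simp add: in_coset_iff algebra_simps)
  next
    fix y assume "y \<in> ?R"
    moreover have "f \<in> B +>\<^bsub>poly_ring\<^esub> f" by (simp add: in_coset_iff I)
    ultimately show "y \<in> ?L" by blast
  qed
  moreover have "B +>\<^bsub>poly_ring\<^esub> c = B \<longleftrightarrow> c \<in> B" for c
  proof
    assume "B +>\<^bsub>poly_ring\<^esub> c = B"
    then have "0 - c \<in> B" using I(1) in_coset_iff[of 0 B c] by simp
    from I(3)[OF I(1) this] show "c \<in> B" by simp
  next
    assume c: "c \<in> B"
    have "y - c \<in> B \<longleftrightarrow> y \<in> B" for y
      using I(2)[OF _ c, of "y - c"] I(3)[OF _ c, of y] by auto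
    then show "B +>\<^bsub>poly_ring\<^esub> c = B" unfolding set_eq_iff in_coset_iff by blast
  qed
  ultimately show ?thesis by (simp add: annihilator_def quotient_module_def)
qed

text \<open>The prime is determined by the annihilated element, so the nested infima over primes and
  over degrees merge into one.\<close>

lemma v_quotient_eq_Inf:
  fixes A B :: "('v::finite, 'k::field) mpoly set"
  assumes "ideal B poly_ring"
  shows "v_quotient A B =
    Inf {enat d |d. \<exists>f\<in>A \<inter> homogeneous_component d. primeideal {r. r * f \<in> B} poly_ring}"
    (is "_ = Inf ?S")
proof -
  let ?M = "quotient_module poly_ring A B"
  have car: "carrier ?M = (\<lambda>a. B +>\<^bsub>poly_ring\<^esub> a) ` A" by (simp add: quotient_module_def)
  show ?thesis
  proof (rule antisym)
    show "v_quotient A B \<le> Inf ?S"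
    proof (rule Inf_greatest)
      fix x assume "x \<in> ?S"
      then obtain d f where f: "x = enat d" "f \<in> A" "f \<in> homogeneous_component d"
        "primeideal {r. r * f \<in> B} poly_ring" by blast
      let ?P = "{r. r * f \<in> B}"
      have "?P \<in> associated_primes poly_ring ?M"
        using f annihilator_coset[OF assms] by (auto simp: associated_primes_def car)
      moreover have "v_number_at poly_ring ?M (quotient_grading A B) ?P \<le> x"
        unfolding v_number_at_def f(1)
        by (rule Inf_lower) (use f annihilator_coset[OF assms] in \<open>auto simp: quotient_grading_def\<close>)
      ultimately show "v_quotient A B \<le> x"
        unfolding v_quotient_def v_number_def by (rule INF_lower2)
    qed
    show "Inf ?S \<le> v_quotient A B"
      unfolding v_quotient_def v_number_def v_number_at_def
    proof (intro INF_greatest Inf_superset_mono subsetI)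
      fix P x
      assume P: "P \<in> associated_primes poly_ring ?M"
        and "x \<in> {enat d |d. \<exists>m\<in>quotient_grading A B d. annihilator poly_ring ?M m = P}"
      then obtain d f where "x = enat d" "f \<in> A \<inter> homogeneous_component d" "{r. r * f \<in> B} = P"
        using annihilator_coset[OF assms] by (auto simp: quotient_grading_def)
      with P show "x \<in> ?S" by (auto simp: associated_primes_def)
    qed
  qed
qed

lemma colon_monom:
  "{r. r * monom w \<in> monomial_ideal Q} = (monomial_ideal {a. a + w \<in> Q} :: ('v, 'k::field) mpoly set)"
  by (subst mult.commute) (auto simp: monomial_ideal_def keys_single_times add.commute)

text \<open>\<open>C\<close> lists the variables that generate the colon ideal of \<open>w\<close>.
  The case \<open>C = {}\<close> is the zero ideal, which is prime too.\<close>

lemma v_quotient_monomial_ideal: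
  fixes A B :: "('v::finite \<Rightarrow>\<^sub>0 nat) set"
  assumes B: "absorbing B"
  shows "v_quotient (monomial_ideal A :: ('v, 'k::field) mpoly set) (monomial_ideal B) =
    Inf {enat (degree_in UNIV w) |w. w \<in> A \<and> (\<exists>C. \<forall>a. a + w \<in> B \<longleftrightarrow> 0 < degree_in C a)}"
    (is "_ = Inf ?S")
proof -
  let ?prime = "\<lambda>f :: ('v, 'k) mpoly. primeideal {r. r * f \<in> monomial_ideal B} poly_ring"
  have monom: "?prime (monom w) \<longleftrightarrow> (\<exists>C. \<forall>a. a + w \<in> B \<longleftrightarrow> 0 < degree_in C a)" for w
  proof
    assume "?prime (monom w)"
    moreover have "absorbing {a. a + w \<in> B}"
      using absorbingD[OF B] by (auto simp: absorbing_def) (metis add.assoc add.commute)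
    ultimately have "{a. a + w \<in> B} = {a. 0 < degree_in {v. var v \<in> {a. a + w \<in> B}} a}"
      unfolding colon_monom by (rule prime_monomial_idealD[rotated])
    then show "\<exists>C. \<forall>a. a + w \<in> B \<longleftrightarrow> 0 < degree_in C a" by blast
  next
    assume "\<exists>C. \<forall>a. a + w \<in> B \<longleftrightarrow> 0 < degree_in C a"
    then show "?prime (monom w)" unfolding colon_monom using primeideal_degree_in_pos by auto
  qed
  have "{enat d |d. \<exists>f\<in>monomial_ideal A \<inter> homogeneous_component d. ?prime f} = ?S"
  proof (intro subset_antisym subsetI)
    fix x assume "x \<in> {enat d |d. \<exists>f\<in>monomial_ideal A \<inter> homogeneous_component d. ?prime f}"
    then obtain d f where f: "x = enat d" "f \<in> monomial_ideal A" "f \<in> homogeneous_component d" "?prime f"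
      by blast
    obtain w where w: "w \<in> keys f" "{r. r * f \<in> monomial_ideal B} = monomial_ideal {a. a + w \<in> B}"
      using prime_colon_eq_colon_monom[OF B f(4)] by blast
    have "\<exists>C. \<forall>a. a + w \<in> B \<longleftrightarrow> 0 < degree_in C a"
      using f(4) w(2) by (simp add: colon_monom flip: monom)
    \<comment> \<open>Passing from \<open>f\<close> to its term \<open>w\<close> keeps the degree by
      homogeneity, and keeps membership because the numerator is a monomial ideal.\<close>
    moreover have "w \<in> A" "degree_in UNIV w = d"
      using f w(1) by (auto simp: monomial_ideal_def homogeneous_component_def degree_in_def)
    ultimately show "x \<in> ?S" unfolding f(1) by blast
  next
    fix x assume "x \<in> ?S"
    then obtain w where w: "x = enat (degree_in UNIV w)" "w \<in> A" "?prime (monom w)"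
      unfolding monom by blast
    then show "x \<in> {enat d |d. \<exists>f\<in>monomial_ideal A \<inter> homogeneous_component d. ?prime f}"
      by (auto simp: homogeneous_component_def degree_in_def
          intro!: bexI[of _ "monom w"])
  qed
  then show ?thesis
    unfolding v_quotient_eq_Inf[OF ideal_monomial_ideal[OF B]] by (rule arg_cong)
qed

section \<open>The symbolic square of an edge ideal\<close>

text \<open>The exponent of the squarefree monomial \<open>x_S\<close>.\<close>

definition indic :: "'v::finite set \<Rightarrow> ('v \<Rightarrow>\<^sub>0 nat)" where
  "indic S = (\<Sum>v\<in>S. var v)"

lemma lookup_indic: "lookup (indic S) v = (if v \<in> S then 1 else 0)"
  by (simp add: indic_def lookup_sum lookup_single when_def)

lemma degree_in_indic: "degree_in UNIV (indic S) = card S"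
  by (simp add: degree_in_def lookup_indic flip: sum.inter_filter)

lemma eq_indic_plus:
  assumes "\<And>v. v \<in> S \<Longrightarrow> 0 < lookup a v"
  shows "a = indic S + (a - indic S)"
proof (rule poly_mapping_eqI)
  fix v show "lookup a v = lookup (indic S + (a - indic S)) v"
    using assms[of v] by (simp add: lookup_add lookup_minus lookup_indic)
qed

text \<open>The monomials of the edge ideal, described through divisibility by the monomial of an
  edge; see \<open>edge_ideal_eq\<close>.\<close>

definition edge_exps :: "'v set set \<Rightarrow> ('v \<Rightarrow>\<^sub>0 nat) set" where
  "edge_exps E = {a. \<exists>e\<in>E. \<forall>v\<in>e. 0 < lookup a v}"

definition edge_pair_exps :: "'v set set \<Rightarrow> ('v \<Rightarrow>\<^sub>0 nat) set" where
  "edge_pair_exps E = {a + b |a b. a \<in> edge_exps E \<and> b \<in> edge_exps E}"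

lemma absorbing_edge_exps: "absorbing (edge_exps E)"
  by (force simp: absorbing_def edge_exps_def lookup_add)

lemma absorbing_edge_pair_exps: "absorbing (edge_pair_exps E)"
  unfolding absorbing_def
proof (intro ballI allI)
  fix w d assume "w \<in> edge_pair_exps E"
  then obtain a b where "w = a + b" "a \<in> edge_exps E" "b \<in> edge_exps E"
    unfolding edge_pair_exps_def by blast
  then have "w + d = a + (b + d) \<and> a \<in> edge_exps E \<and> b + d \<in> edge_exps E"
    using absorbingD[OF absorbing_edge_exps] by (simp add: add.assoc)
  then show "w + d \<in> edge_pair_exps E" unfolding edge_pair_exps_def by blast
qed

text \<open>Membership in the square of the edge ideal means divisibility by \<open>x_e x_f\<close>,
  where \<open>e = f\<close> is allowed; a vertex shared by \<open>e\<close> and \<open>f\<close>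
  needs exponent 2. For the converse, \<open>w\<close> splits into \<open>indic e\<close> and the
  rest, which is still divisible by \<open>x_f\<close>.\<close>

lemma edge_pair_exps_iff:
  fixes w :: "'v::finite \<Rightarrow>\<^sub>0 nat"
  shows "w \<in> edge_pair_exps E \<longleftrightarrow> (\<exists>e\<in>E. \<exists>f\<in>E. \<forall>v. of_bool (v \<in> e) + of_bool (v \<in> f) \<le> lookup w v)"
proof
  assume "w \<in> edge_pair_exps E"
  then obtain a b where w: "w = a + b" and "a \<in> edge_exps E" "b \<in> edge_exps E"
    unfolding edge_pair_exps_def by blast
  then obtain e f where ef: "e \<in> E" "f \<in> E" "\<forall>v\<in>e. 0 < lookup a v" "\<forall>v\<in>f. 0 < lookup b v"
    unfolding edge_exps_def by blast
  have "of_bool (v \<in> e) + of_bool (v \<in> f) \<le> lookup w v" for v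
    unfolding w lookup_add using ef by (intro add_mono) (auto simp: Suc_le_eq)
  then show "\<exists>e\<in>E. \<exists>f\<in>E. \<forall>v. of_bool (v \<in> e) + of_bool (v \<in> f) \<le> lookup w v"
    using ef by blast
next
  assume "\<exists>e\<in>E. \<exists>f\<in>E. \<forall>v. of_bool (v \<in> e) + of_bool (v \<in> f) \<le> lookup w v"
  then obtain e f where ef: "e \<in> E" "f \<in> E" "\<And>v. of_bool (v \<in> e) + of_bool (v \<in> f) \<le> lookup w v"
    by blast
  have e: "0 < lookup w v" if "v \<in> e" for v using ef(3)[of v] that by (auto split: if_splits)
  have "indic e \<in> edge_exps E" using ef(1) by (auto simp: edge_exps_def lookup_indic)
  moreover have "\<forall>v\<in>f. 0 < lookup (w - indic e) v"
    using ef(3) by (fastforce simp: lookup_minus lookup_indic of_bool_def split: if_splits)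
  then have "w - indic e \<in> edge_exps E" using ef(2) by (auto simp: edge_exps_def)
  ultimately show "w \<in> edge_pair_exps E"
    using eq_indic_plus[of e w, OF e] unfolding edge_pair_exps_def by blast
qed

lemma edge_ideal_eq:
  fixes G :: "'v::finite ugraph"
  assumes "\<And>e. e \<in> edges G \<Longrightarrow> card e = 2"
  shows "edge_ideal G = (monomial_ideal (edge_exps (edges G)) :: ('v, 'k::field) mpoly set)"
proof -
  let ?S = "{var i + var j |i j. {i, j} \<in> edges G}"
  have "{indet i * indet j |i j. {i, j} \<in> edges G} = (monom ` ?S :: ('v, 'k) mpoly set)"
    by (auto simp: indet_def mult_single image_iff)
  then have "edge_ideal G = (monomial_ideal {s + t |s t. s \<in> ?S} :: ('v, 'k) mpoly set)"
    unfolding edge_ideal_def by (simp only: genideal_monoms)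
  also have "{s + t |s t. s \<in> ?S} = edge_exps (edges G)"
  proof (intro subset_antisym subsetI)
    fix a assume "a \<in> {s + t |s t. s \<in> ?S}"
    then obtain i j t where "a = var i + var j + t" "{i, j} \<in> edges G" by blast
    then show "a \<in> edge_exps (edges G)"
      unfolding edge_exps_def by (auto intro!: bexI[of _ "{i, j}"] simp: lookup_add)
  next
    fix a assume "a \<in> edge_exps (edges G)"
    then obtain e where e: "e \<in> edges G" "\<forall>v\<in>e. 0 < lookup a v" by (auto simp: edge_exps_def)
    obtain i j where ij: "e = {i, j}" "i \<noteq> j" using assms[OF e(1)] by (meson card_2_iff)
    have "indic e = var i + var j" using ij by (simp add: indic_def)
    then have "a = (var i + var j) + (a - indic e)" using eq_indic_plus[of e a] e(2) by metis
    then show "a \<in> {s + t |s t. s \<in> ?S}" using e(1) ij by blast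
  qed
  finally show ?thesis .
qed

section \<open>Contractions from localizations\<close>

lemma loc_contraction_eq:
  fixes J P :: "('v, 'k::field) mpoly set"
  assumes J: "ideal J poly_ring" and P: "primeideal P poly_ring"
  shows "loc_contraction poly_ring J P = {f. \<exists>s. s \<notin> P \<and> s * f \<in> J}"
proof -
  have "ideal P poly_ring" "P \<noteq> UNIV" and prime: "\<And>x y. x * y \<in> P \<Longrightarrow> x \<in> P \<or> y \<in> P"
    using P unfolding primeideal_poly_ring_iff by blast+
  then have "1 \<notin> P" using ideal_poly_ringD(4)[of P 1] by auto
  show ?thesis
  proof (intro subset_antisym subsetI)
    fix f assume "f \<in> loc_contraction poly_ring J P"
    then obtain a s u where *: "a \<in> J" "s \<notin> P" "u \<notin> P" "u * (f * s - a) = 0"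
      by (auto simp: loc_contraction_def loc_eq_def)
    \<comment> \<open>The denominator \<open>s\<close> and the witness \<open>u\<close> of the
      equality of fractions combine to a single multiplier outside \<open>P\<close>.\<close>
    then have "(u * s) * f = u * a" by (simp add: algebra_simps)
    then have "(u * s) * f \<in> J" using ideal_poly_ringD(4)[OF J *(1)] by simp
    moreover have "u * s \<notin> P" using prime *(2,3) by blast
    ultimately show "f \<in> {f. \<exists>s. s \<notin> P \<and> s * f \<in> J}" by blast
  next
    fix f assume "f \<in> {f. \<exists>s. s \<notin> P \<and> s * f \<in> J}"
    then obtain s where "s \<notin> P" "s * f \<in> J" by blast
    moreover have "loc_eq poly_ring P (f, 1) (s * f, s)"
      using \<open>1 \<notin> P\<close> by (auto simp: loc_eq_def mult.commute intro!: bexI[of _ 1])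
    ultimately show "f \<in> loc_contraction poly_ring J P"
      by (auto simp: loc_contraction_def)
  qed
qed

lemma ideal_loc_contraction:
  fixes J P :: "('v, 'k::field) mpoly set"
  assumes J: "ideal J poly_ring" and P: "primeideal P poly_ring"
  shows "ideal (loc_contraction poly_ring J P) poly_ring"
proof -
  note I = ideal_poly_ringD[OF J]
  have "ideal P poly_ring" "P \<noteq> UNIV" and prime: "\<And>x y. x * y \<in> P \<Longrightarrow> x \<in> P \<or> y \<in> P"
    using P unfolding primeideal_poly_ring_iff by blast+
  show ?thesis
    unfolding loc_contraction_eq[OF assms]
  proof (rule ideal_poly_ringI)
    show "0 \<in> {f. \<exists>s. s \<notin> P \<and> s * f \<in> J}" using \<open>P \<noteq> UNIV\<close> I(1) by auto
    fix x y r
    assume "x \<in> {f. \<exists>s. s \<notin> P \<and> s * f \<in> J}"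
    then obtain s where s: "s \<notin> P" "s * x \<in> J" by blast
    then have "s * (r * x) \<in> J" using I(4)[of "s * x" r] by (metis mult.left_commute)
    with s(1) show "r * x \<in> {f. \<exists>s. s \<notin> P \<and> s * f \<in> J}" by blast
    assume "y \<in> {f. \<exists>s. s \<notin> P \<and> s * f \<in> J}"
    then obtain t where t: "t \<notin> P" "t * y \<in> J" by blast
    have "(s * t) * (x + y) = t * (s * x) + s * (t * y)" by (simp add: algebra_simps)
    then have "(s * t) * (x + y) \<in> J" using I(2)[OF I(4)[OF s(2)] I(4)[OF t(2)]] by simp
    moreover have "s * t \<notin> P" using prime s(1) t(1) by blast
    ultimately show "x + y \<in> {f. \<exists>s. s \<notin> P \<and> s * f \<in> J}" by blast
  qed
qed

text \<open>Powers of a prime generated by variables are primary: \<open>g\<close> has a term free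
  of \<open>C\<close>, so the least \<open>C\<close>-degree in \<open>g * f\<close> equals the least
  \<open>C\<close>-degree in \<open>f\<close>.\<close>

lemma degree_in_ge_if_multiple:
  fixes f g :: "('v::finite, 'k::field) mpoly"
  assumes "g * f \<in> monomial_ideal {a. n \<le> degree_in C a}" "g \<notin> monomial_ideal {a. 0 < degree_in C a}"
  shows "f \<in> monomial_ideal {a. n \<le> degree_in C a}"
proof (cases "f = 0")
  case False
  obtain a0 where a0: "a0 \<in> keys g" "degree_in C a0 = 0"
    using assms(2) by (auto simp: monomial_ideal_def)
  then have "g \<noteq> 0" by auto
  then obtain a b where ab: "a + b \<in> keys (g * f)" "\<And>a'. a' \<in> keys g \<Longrightarrow> degree_in C a \<le> degree_in C a'"
    "\<And>b'. b' \<in> keys f \<Longrightarrow> degree_in C b \<le> degree_in C b'"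
    using exists_least_degree_product_key[of "degree_in C" g f, OF degree_in_add] False by metis
  have "n \<le> degree_in C (a + b)" using ab(1) assms(1) by (auto simp: monomial_ideal_def)
  then have "n \<le> degree_in C b" using ab(2)[OF a0(1)] a0(2) by (simp add: degree_in_add)
  then show ?thesis using ab(3) by (force simp: monomial_ideal_def)
qed (simp add: monomial_ideal_def)

section \<open>Vertex covers and pairwise intersecting edges\<close>

definition vertex_cover :: "'v set set \<Rightarrow> 'v set \<Rightarrow> bool" where
  "vertex_cover E C \<longleftrightarrow> (\<forall>e\<in>E. e \<inter> C \<noteq> {})"

text \<open>This exhibits the prime of a minimal vertex cover as an associated prime, namely as the
  annihilator of the product of all variables outside \<open>C\<close>. By minimality, each
  \<open>c\<close> in \<open>C\<close> lies on an edge that has no other vertex in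
  \<open>C\<close>.\<close>

lemma colon_minimal_vertex_cover:
  fixes C :: "'v::finite set"
  assumes "vertex_cover E C" and "\<And>D. vertex_cover E D \<Longrightarrow> D \<subseteq> C \<Longrightarrow> C = D"
  shows "a + indic (- C) \<in> edge_exps E \<longleftrightarrow> 0 < degree_in C a"
proof
  assume "a + indic (- C) \<in> edge_exps E"
  then obtain e where "e \<in> E" "\<forall>v\<in>e. 0 < lookup a v \<or> v \<notin> C"
    by (auto simp: edge_exps_def lookup_add lookup_indic split: if_splits)
  then show "0 < degree_in C a"
    using assms(1) by (fastforce simp: vertex_cover_def degree_in_pos_iff)
next
  assume "0 < degree_in C a"
  then obtain c where c: "c \<in> C" "0 < lookup a c" by (auto simp: degree_in_pos_iff)
  have "\<not> vertex_cover E (C - {c})" using assms(2)[of "C - {c}"] c(1) by blast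
  then obtain e where e: "e \<in> E" "e \<inter> (C - {c}) = {}" by (auto simp: vertex_cover_def)
  then have "\<forall>v\<in>e. 0 < lookup (a + indic (- C)) v"
    using c by (auto simp: lookup_add lookup_indic)
  with e(1) show "a + indic (- C) \<in> edge_exps E" by (auto simp: edge_exps_def)
qed

lemma card_2_elemE:
  assumes "card e = 2" "a \<in> e"
  obtains c where "c \<noteq> a" "e = {a, c}"
proof -
  obtain x y where "e = {x, y}" "x \<noteq> y" using assms(1) by (meson card_2_iff)
  with assms(2) consider "e = {a, y}" "y \<noteq> a" | "e = {a, x}" "x \<noteq> a" by blast
  then show thesis using that by cases
qed

text \<open>Fix an edge with ends \<open>a\<close> and \<open>b\<close>. If neither end is common to
  all edges, then an edge missing \<open>a\<close> contains \<open>b\<close>, an edge missing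
  \<open>b\<close> contains \<open>a\<close>, and these two meet in a third vertex.\<close>

lemma intersecting_edges_star_or_triangle:
  assumes "\<And>e. e \<in> F \<Longrightarrow> card e = 2" and "\<And>e f. e \<in> F \<Longrightarrow> f \<in> F \<Longrightarrow> e \<inter> f \<noteq> {}"
    and "F \<noteq> {}"
  shows "(\<exists>a b. a \<noteq> b \<and> {a, b} \<in> F \<and> (\<forall>e\<in>F. a \<in> e)) \<or>
    (\<exists>a b c. a \<noteq> b \<and> a \<noteq> c \<and> b \<noteq> c \<and> {a, b} \<in> F \<and> {a, c} \<in> F \<and> {b, c} \<in> F)"
proof -
  obtain a b where ab: "{a, b} \<in> F" "a \<noteq> b" using assms(1,3) by (metis card_2_iff ex_in_conv)
  show ?thesis
  proof (cases "(\<forall>e\<in>F. a \<in> e) \<or> (\<forall>e\<in>F. b \<in> e)")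
    case True
    then show ?thesis using ab by (metis insert_commute)
  next
    case False
    then obtain e f where ef: "e \<in> F" "a \<notin> e" "f \<in> F" "b \<notin> f" by blast
    have "b \<in> e" "a \<in> f" using assms(2)[OF ab(1) ef(1)] assms(2)[OF ab(1) ef(3)] ef by auto
    then obtain c d where cd: "e = {b, c}" "f = {a, d}" "b \<noteq> c" "a \<noteq> d"
      using assms(1)[OF ef(1)] assms(1)[OF ef(3)] by (auto simp: card_2_iff doubleton_eq_iff)
    then have "c = d" using assms(2)[OF ef(1,3)] ef ab by auto
    then have "{a, c} \<in> F" "{b, c} \<in> F" "a \<noteq> c" using ef cd by simp_all
    then show ?thesis using ab cd(3) by blast
  qed
qed

text \<open>The zero set of \<open>w\<close> costs no degree and covers all edges except those in
  \<open>F\<close>, the edges dividing \<open>w\<close>. The edges in \<open>F\<close> meet pairwise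
  as \<open>w\<close> is outside the square, and they contain no triangle, so they form a star. It
  remains to cover the star by a vertex of exponent 1.\<close>

lemma exists_cover_of_small_degree:
  fixes w :: "'v::finite \<Rightarrow>\<^sub>0 nat"
  assumes E: "\<And>e. e \<in> E \<Longrightarrow> card e = 2" and w: "w \<notin> edge_pair_exps E"
    and triangle: "\<And>a b c. a \<noteq> b \<Longrightarrow> a \<noteq> c \<Longrightarrow> b \<noteq> c \<Longrightarrow> {a, b} \<in> E \<Longrightarrow> {a, c} \<in> E \<Longrightarrow> {b, c} \<in> E \<Longrightarrow>
      lookup w a = 0 \<or> lookup w b = 0 \<or> lookup w c = 0"
  obtains C where "vertex_cover E C" "degree_in C w \<le> 1"
proof -
  define F where "F = {e \<in> E. \<forall>v\<in>e. 0 < lookup w v}"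
  let ?Z = "{v. lookup w v = 0}"
  have pair: False if "e \<in> F" "f \<in> F" "\<And>v. v \<in> e \<Longrightarrow> v \<in> f \<Longrightarrow> 2 \<le> lookup w v" for e f
  proof -
    have "of_bool (v \<in> e) + of_bool (v \<in> f) \<le> lookup w v" for v
      using that by (auto simp: F_def of_bool_def Suc_le_eq numeral_2_eq_2)
    then show False using w that(1,2) unfolding edge_pair_exps_iff F_def by blast
  qed
  show thesis
  proof (cases "F = {}")
    case True
    then have "vertex_cover E ?Z" by (auto simp: F_def vertex_cover_def)
    moreover have "degree_in ?Z w = 0" by (simp add: degree_in_eq_0_iff)
    ultimately show thesis using that by simp
  next
    case False
    have F2: "card e = 2" if "e \<in> F" for e using that E by (simp add: F_def)
    have meet: "e \<inter> f \<noteq> {}" if "e \<in> F" "f \<in> F" for e f using pair[OF that] by blast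
    have no_triangle: "\<not> (\<exists>a b c. a \<noteq> b \<and> a \<noteq> c \<and> b \<noteq> c \<and> {a, b} \<in> F \<and> {a, c} \<in> F \<and> {b, c} \<in> F)"
      using triangle by (fastforce simp: F_def)
    then obtain a b where ab: "a \<noteq> b" "{a, b} \<in> F" "\<forall>e\<in>F. a \<in> e"
      using intersecting_edges_star_or_triangle[OF F2 meet False] by blast
    have cover: "\<And>x. \<forall>e\<in>F. x \<in> e \<Longrightarrow> lookup w x = 1 \<Longrightarrow> thesis"
    proof (rule that)
      fix x assume x: "\<forall>e\<in>F. x \<in> e" "lookup w x = 1"
      show "vertex_cover E (insert x ?Z)" using x(1) by (auto simp: F_def vertex_cover_def)
      show "degree_in (insert x ?Z) w \<le> 1" using x(2) by (simp add: degree_in_def)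
    qed
    show thesis
    proof (cases "lookup w a = 1")
      case True
      with cover ab(3) show thesis by blast
    next
      case False
      moreover have "0 < lookup w a" "0 < lookup w b" using ab(2) by (auto simp: F_def)
      ultimately have a2: "2 \<le> lookup w a" by linarith
      \<comment> \<open>Two distinct edges meeting only in \<open>a\<close>, where the exponent is
        at least 2, would have a product dividing \<open>w\<close>.\<close>
      have only: "e = {a, b}" if eF: "e \<in> F" for e
      proof (rule ccontr)
        assume "e \<noteq> {a, b}"
        moreover obtain c where "e = {a, c}"
          using F2[OF eF] ab(3) eF by (meson card_2_elemE)
        ultimately have "b \<noteq> c" by blast
        with pair[OF ab(2) eF] \<open>e = {a, c}\<close> a2 ab(1) show False by auto
      qed
      \<comment> \<open>Otherwise the square of the monomial of the edge \<open>{a, b}\<close> would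
        divide \<open>w\<close>; hence \<open>b\<close> can serve as the cover vertex.\<close>
      have "\<not> 2 \<le> lookup w b" using pair[OF ab(2) ab(2)] a2 by auto
      then have "lookup w b = 1" using \<open>0 < lookup w b\<close> by linarith
      with cover[of b] only show thesis by auto
    qed
  qed
qed

section \<open>Triangles and the colon ideal of the square\<close>

lemma is_triangle_iff:
  assumes "vertices G = UNIV"
  shows "is_triangle G T \<longleftrightarrow> (\<exists>a b c. T = {a, b, c} \<and> a \<noteq> b \<and> a \<noteq> c \<and> b \<noteq> c \<and>
    {a, b} \<in> edges G \<and> {a, c} \<in> edges G \<and> {b, c} \<in> edges G)"
proof
  assume T: "is_triangle G T"
  then obtain a b c where "T = {a, b, c}" "a \<noteq> b" "b \<noteq> c" "a \<noteq> c"
    unfolding is_triangle_def card_3_iff by blast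
  moreover from this T have "{a, b} \<in> edges G" "{a, c} \<in> edges G" "{b, c} \<in> edges G"
    unfolding is_triangle_def by blast+
  ultimately show "\<exists>a b c. T = {a, b, c} \<and> a \<noteq> b \<and> a \<noteq> c \<and> b \<noteq> c \<and>
    {a, b} \<in> edges G \<and> {a, c} \<in> edges G \<and> {b, c} \<in> edges G"
    by blast
next
  assume "\<exists>a b c. T = {a, b, c} \<and> a \<noteq> b \<and> a \<noteq> c \<and> b \<noteq> c \<and>
    {a, b} \<in> edges G \<and> {a, c} \<in> edges G \<and> {b, c} \<in> edges G"
  then show "is_triangle G T"
    using assms by (auto simp: is_triangle_def insert_commute)
qed

lemma triangle_at_vertex:
  assumes "vertices G = UNIV" "is_triangle G T" "a \<in> T"
  obtains b c where "T = {a, b, c}" "a \<noteq> b" "a \<noteq> c" "b \<noteq> c"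
    "{a, b} \<in> edges G" "{a, c} \<in> edges G" "{b, c} \<in> edges G"
proof -
  obtain x y z where T: "T = {x, y, z}" "x \<noteq> y" "x \<noteq> z" "y \<noteq> z"
    "{x, y} \<in> edges G" "{x, z} \<in> edges G" "{y, z} \<in> edges G"
    using assms(1,2) by (auto simp: is_triangle_iff)
  then consider "a = x" | "a = y" | "a = z" using assms(3) by blast
  then show thesis
  proof cases
    case 1
    with T show thesis by (intro that[of y z]) auto
  next
    case 2
    with T show thesis by (intro that[of x z]) (auto simp: insert_commute)
  next
    case 3
    with T show thesis by (intro that[of x y]) (auto simp: insert_commute)
  qed
qed

definition triangle_exps :: "'v ugraph \<Rightarrow> ('v \<Rightarrow>\<^sub>0 nat) set" where
  "triangle_exps G = {a. \<exists>T. is_triangle G T \<and> (\<forall>v\<in>T. 0 < lookup a v)}"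

text \<open>If \<open>b\<close> avoids \<open>N\<close> and contains no edge outside
  \<open>N\<close>, two edges whose product divides \<open>x_T\<close> times \<open>b\<close> would
  both lie in \<open>T\<close> and share a vertex of exponent 1. Conversely, a vertex of
  \<open>T\<close> gives two triangle edges at that vertex, and a neighbour of \<open>u\<close> in
  \<open>T\<close> gives its edge to \<open>u\<close> together with the triangle edge opposite to
  \<open>u\<close>.\<close>

lemma edge_square_colon_triangle:
  fixes G :: "'v::finite ugraph"
  assumes G: "simple_graph G" "vertices G = UNIV" and T: "is_triangle G T"
  defines "N \<equiv> closed_nbhd G T"
  shows "b + indic T \<in> edge_pair_exps (edges G) \<longleftrightarrow>
    0 < degree_in N b \<or> b \<in> edge_exps (edges (delete_vertices G N))"
proof -
  have E: "\<And>e. e \<in> edges G \<Longrightarrow> card e = 2" using G(1) by (simp add: simple_graph_def)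
  have "T \<subseteq> N" by (simp add: N_def closed_nbhd_def)
  have EH: "edges (delete_vertices G N) = {e \<in> edges G. e \<inter> N = {}}"
    by (auto simp: delete_vertices_def G(2))
  show ?thesis
  proof
    assume "b + indic T \<in> edge_pair_exps (edges G)"
    then obtain e f where ef: "e \<in> edges G" "f \<in> edges G"
      "\<And>v. of_bool (v \<in> e) + of_bool (v \<in> f) \<le> lookup b v + of_bool (v \<in> T)"
      unfolding edge_pair_exps_iff lookup_add lookup_indic by (auto simp: of_bool_def)
    show "0 < degree_in N b \<or> b \<in> edge_exps (edges (delete_vertices G N))"
    proof (rule ccontr)
      assume "\<not> ?thesis"
      then have b0: "\<And>v. v \<in> N \<Longrightarrow> lookup b v = 0" and b1: "b \<notin> edge_exps (edges (delete_vertices G N))"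
        by (auto simp: degree_in_pos_iff)
      \<comment> \<open>Such an edge meets \<open>N\<close>, and as \<open>b\<close> vanishes there,
        it does so only inside \<open>T\<close>. Having one end in \<open>T\<close>, its other end
        is in \<open>N\<close>, hence in \<open>T\<close> as well.\<close>
      have in_T: "g \<subseteq> T" if g: "g \<in> edges G" "\<And>v. v \<in> g \<Longrightarrow> 1 \<le> lookup b v + of_bool (v \<in> T)" for g
      proof -
        have "\<not> g \<inter> N = {}"
        proof
          assume gN: "g \<inter> N = {}"
          then have "0 < lookup b v" if "v \<in> g" for v
            using g(2)[OF that] that \<open>T \<subseteq> N\<close> by (auto simp: of_bool_def split: if_splits)
          then have "b \<in> edge_exps (edges (delete_vertices G N))"
            unfolding edge_exps_def EH using g(1) gN by blast
          with b1 show False ..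
        qed
        moreover have NT: "v \<in> T" if "v \<in> g" "v \<in> N" for v
          using g(2)[OF that(1)] b0[OF that(2)] by (auto simp: of_bool_def split: if_splits)
        ultimately obtain u where u: "u \<in> g" "u \<in> T" by blast
        have "v \<in> N" if "v \<in> g" for v
        proof (cases "v = u")
          case False
          then have "g = {u, v}" using E[OF g(1)] u(1) that by (auto simp: card_2_iff)
          then show ?thesis using g(1) u(2) G(2) by (auto simp: N_def closed_nbhd_def)
        qed (use u \<open>T \<subseteq> N\<close> in blast)
        with NT show ?thesis by blast
      qed
      have "e \<subseteq> T" by (rule in_T[OF ef(1)]) (use ef(3) in \<open>force simp: of_bool_def split: if_splits\<close>)
      moreover have "f \<subseteq> T" by (rule in_T[OF ef(2)]) (use ef(3) in \<open>force simp: of_bool_def split: if_splits\<close>)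
      \<comment> \<open>Two 2-element subsets of a 3-element set intersect.\<close>
      ultimately have "card (e \<union> f) \<le> 3"
        using T card_mono[of T "e \<union> f"] by (auto simp: is_triangle_def)
      then have "card (e \<inter> f) \<noteq> 0"
        using card_Un_Int[OF finite finite, of e f] E[OF ef(1)] E[OF ef(2)] by linarith
      then have "e \<inter> f \<noteq> {}" by (metis card.empty)
      then obtain v where v: "v \<in> e" "v \<in> f" by blast
      then have "v \<in> T" "v \<in> N" using \<open>e \<subseteq> T\<close> \<open>T \<subseteq> N\<close> by blast+
      with v show False using ef(3)[of v] b0[of v] by simp
    qed
  next
    assume "0 < degree_in N b \<or> b \<in> edge_exps (edges (delete_vertices G N))"
    then show "b + indic T \<in> edge_pair_exps (edges G)"
    proof
      assume "0 < degree_in N b"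
      then obtain v where v: "v \<in> N" "0 < lookup b v" by (auto simp: degree_in_pos_iff)
      show ?thesis
      proof (cases "v \<in> T")
        case True
        obtain x y where xy: "T = {v, x, y}" "v \<noteq> x" "v \<noteq> y" "x \<noteq> y"
          "{v, x} \<in> edges G" "{v, y} \<in> edges G"
          using triangle_at_vertex[OF G(2) T True] by metis
        then show ?thesis unfolding edge_pair_exps_iff
          by (intro bexI[of _ "{v, x}"] bexI[of _ "{v, y}"])
            (use v(2) in \<open>auto simp: lookup_add lookup_indic\<close>)
      next
        case False
        then obtain u where u: "u \<in> T" "{u, v} \<in> edges G"
          using v(1) by (auto simp: N_def closed_nbhd_def)
        obtain x y where xy: "T = {u, x, y}" "u \<noteq> x" "u \<noteq> y" "x \<noteq> y" "{x, y} \<in> edges G"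
          using triangle_at_vertex[OF G(2) T u(1)] by metis
        then show ?thesis unfolding edge_pair_exps_iff
          by (intro bexI[of _ "{u, v}"] bexI[of _ "{x, y}"])
            (use v(2) u(2) False in \<open>auto simp: lookup_add lookup_indic\<close>)
      qed
    next
      assume "b \<in> edge_exps (edges (delete_vertices G N))"
      then obtain e where e: "e \<in> edges G" "e \<inter> N = {}" "\<forall>v\<in>e. 0 < lookup b v"
        by (auto simp: edge_exps_def EH)
      obtain x y z where xy: "T = {x, y, z}" "{x, y} \<in> edges G"
        using T G(2) by (auto simp: is_triangle_iff)
      with e show ?thesis unfolding edge_pair_exps_iff
        by (intro bexI[of _ "e"] bexI[of _ "{x, y}"])
          (use \<open>T \<subseteq> N\<close> in \<open>auto simp: lookup_add lookup_indic of_bool_def Suc_le_eq\<close>)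
    qed
  qed
qed

lemma triangle_multiple_in_edge_square:
  fixes G :: "'v::finite ugraph"
  assumes G: "simple_graph G" "vertices G = UNIV" and T: "is_triangle G T"
    and w: "\<And>v. v \<in> T \<Longrightarrow> 0 < lookup w v" and v: "v \<in> closed_nbhd G T"
  shows "var v + w \<in> edge_pair_exps (edges G)"
proof -
  have w_eq: "w = indic T + (w - indic T)" by (rule eq_indic_plus[OF w])
  have "0 < degree_in (closed_nbhd G T) (var v)"
    using v by (auto simp: degree_in_pos_iff intro!: bexI[of _ v])
  then have "var v + indic T \<in> edge_pair_exps (edges G)"
    using edge_square_colon_triangle[OF G T] by blast
  from absorbingD[OF absorbing_edge_pair_exps this, of "w - indic T"] w_eq
  show ?thesis by (simp add: add.assoc)
qed

text \<open>An associated prime cannot contain all variables of \<open>N[T]\<close>, and any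
  variable of \<open>N[T]\<close> multiplies \<open>x_T\<close> into the square, so
  \<open>x_T\<close> survives in every contraction. Conversely, a monomial outside the right-hand
  side has degree at most 1 in some minimal vertex cover, and contraction at the prime of that cover
  excludes it.\<close>

lemma symbolic_square_edge_ideal:
  fixes G :: "'v::finite ugraph"
  assumes G: "simple_graph G" "vertices G = UNIV"
  shows "symbolic_power poly_ring (edge_ideal G :: ('v, 'k::field) mpoly set) 2 =
    monomial_ideal (edge_pair_exps (edges G) \<union> triangle_exps G)" (is "?L = monomial_ideal ?Q")
proof -
  let ?E = "edges G"
  let ?I = "monomial_ideal (edge_exps ?E) :: ('v, 'k) mpoly set"
  let ?J = "monomial_ideal (edge_pair_exps ?E) :: ('v, 'k) mpoly set"
  let ?Ass = "associated_primes poly_ring (quotient_module poly_ring (carrier poly_ring) ?I)"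
  have E: "\<And>e. e \<in> ?E \<Longrightarrow> card e = 2" using G(1) by (simp add: simple_graph_def)
  have I: "ideal ?I poly_ring" and J: "ideal ?J poly_ring"
    by (rule ideal_monomial_ideal absorbing_edge_exps absorbing_edge_pair_exps)+
  have power: "ideal_power poly_ring ?I 2 = ?J"
    unfolding edge_pair_exps_def by (rule ideal_power_2_monomial_ideal[OF absorbing_edge_exps])
  have edge_ideal: "edge_ideal G = ?I" by (rule edge_ideal_eq) (rule E)
  have L: "?L = (\<Inter>P\<in>?Ass. loc_contraction poly_ring ?J P)"
    unfolding symbolic_power_def edge_ideal power by simp
  have Ass_iff: "P \<in> ?Ass \<longleftrightarrow> primeideal P poly_ring \<and> (\<exists>m. P = {r. r * m \<in> ?I})" for P
    using annihilator_coset[OF I, where A = UNIV]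
    by (auto simp: associated_primes_def quotient_module_def)
  show ?thesis
  proof
    show "monomial_ideal ?Q \<subseteq> ?L"
      unfolding L
    proof (rule INT_greatest)
      fix P assume "P \<in> ?Ass"
      then obtain m where P: "primeideal P poly_ring" and m: "P = {r. r * m \<in> ?I}"
        unfolding Ass_iff by blast
      have idP: "ideal P poly_ring" and "P \<noteq> UNIV" using P unfolding primeideal_poly_ring_iff by blast+
      have "1 \<notin> P" using \<open>P \<noteq> UNIV\<close> ideal_poly_ringD(4)[OF idP, of 1] by auto
      show "monomial_ideal ?Q \<subseteq> loc_contraction poly_ring ?J P"
      proof (rule monomial_ideal_subset[OF ideal_loc_contraction[OF J P]])
        fix w assume "w \<in> ?Q"
        then consider "w \<in> edge_pair_exps ?E" | "w \<in> triangle_exps G" by blast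
        then have "\<exists>s. s \<notin> P \<and> s * monom w \<in> ?J"
        proof cases
          case 1
          then show ?thesis using \<open>1 \<notin> P\<close> by (intro exI[of _ 1]) simp
        next
          case 2
          then obtain T where T: "is_triangle G T" and w: "\<And>v. v \<in> T \<Longrightarrow> 0 < lookup w v"
            by (auto simp: triangle_exps_def)
          have "\<exists>v\<in>closed_nbhd G T. monom (var v) \<notin> P"
          proof (rule ccontr)
            assume "\<not> ?thesis"
            then have all: "\<And>v. v \<in> closed_nbhd G T \<Longrightarrow> monom (var v) * m \<in> ?I" using m by blast
            have "T \<noteq> {}" using T by (auto simp: is_triangle_def)
            then obtain a where a: "a \<in> T" by blast
            have "m \<notin> ?I" using \<open>1 \<notin> P\<close> m by simp
            then obtain u where u: "u \<in> keys m" "u \<notin> edge_exps ?E" by (auto simp: monomial_ideal_def)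
            have mult: "var v + u \<in> edge_exps ?E" if "v \<in> closed_nbhd G T" for v
              using all[OF that] u(1) by (auto simp: monomial_ideal_def keys_single_times)
            have aN: "a \<in> closed_nbhd G T" using a by (simp add: closed_nbhd_def)
            obtain e where e: "e \<in> ?E" "\<And>v. v \<in> e \<Longrightarrow> 0 < lookup (var a + u) v"
              using mult[OF aN] by (auto simp: edge_exps_def)
            have u_pos: "0 < lookup u v" if "v \<in> e" "v \<noteq> a" for v
              using e(2)[OF that(1)] that(2) by (simp add: lookup_add lookup_single)
            have "a \<in> e"
            proof (rule ccontr)
              assume "a \<notin> e"
              then have "0 < lookup u v" if "v \<in> e" for v using u_pos[of v] that by blast
              with e(1) u(2) show False unfolding edge_exps_def by blast
            qed
            \<comment> \<open>As \<open>u\<close> is outside the edge ideal but becomes a member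
              after multiplication by the variable of \<open>a\<close>, it involves a neighbour
              \<open>b\<close> of \<open>a\<close>.\<close>
            then obtain b where b: "b \<noteq> a" "e = {a, b}" by (meson card_2_elemE E e(1))
            then have "b \<in> closed_nbhd G T" using a e(1) G(2) by (auto simp: closed_nbhd_def)
            from mult[OF this] obtain f where f: "f \<in> ?E" "\<And>v. v \<in> f \<Longrightarrow> 0 < lookup (var b + u) v"
              by (auto simp: edge_exps_def)
            \<comment> \<open>Multiplying by the variable of \<open>b\<close> does not enlarge the
              support of \<open>u\<close>, so the edge \<open>f\<close> divides \<open>u\<close>
              already.\<close>
            have "0 < lookup u v" if "v \<in> f" for v
              using f(2)[OF that] u_pos[of b] b
              by (cases "v = b") (auto simp: lookup_add lookup_single)
            with f(1) u(2) show False unfolding edge_exps_def by blast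
          qed
          then obtain v where v: "v \<in> closed_nbhd G T" "monom (var v) \<notin> P" by blast
          have "monom (var v) * monom w \<in> ?J"
            using triangle_multiple_in_edge_square[OF G T w v(1)] by (simp add: mult_single)
          with v(2) show ?thesis by blast
        qed
        then show "monom w \<in> loc_contraction poly_ring ?J P"
          unfolding loc_contraction_eq[OF J P] by blast
      qed
    qed
    show "?L \<subseteq> monomial_ideal ?Q"
    proof
      fix f assume f: "f \<in> ?L"
      have "w \<in> ?Q" if w: "w \<in> keys f" for w
      proof (rule ccontr)
        assume "w \<notin> ?Q"
        then have "w \<notin> edge_pair_exps ?E" and "w \<notin> triangle_exps G" by blast+
        then have no_triangle: "lookup w a = 0 \<or> lookup w b = 0 \<or> lookup w c = 0"
          if "a \<noteq> b" "a \<noteq> c" "b \<noteq> c" "{a, b} \<in> ?E" "{a, c} \<in> ?E" "{b, c} \<in> ?E" for a b c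
        proof -
          have "is_triangle G {a, b, c}" using that unfolding is_triangle_iff[OF G(2)] by blast
          then show ?thesis using \<open>w \<notin> triangle_exps G\<close> by (auto simp: triangle_exps_def)
        qed
        obtain D where D: "vertex_cover ?E D" "degree_in D w \<le> 1"
          using exists_cover_of_small_degree[OF E \<open>w \<notin> edge_pair_exps ?E\<close> no_triangle] by blast
        \<comment> \<open>Shrinking to a minimal cover makes its prime associated and does not raise
          the degree of \<open>w\<close>.\<close>
        obtain C where C: "C \<subseteq> D" "vertex_cover ?E C" "\<And>B. vertex_cover ?E B \<Longrightarrow> B \<subseteq> C \<Longrightarrow> C = B"
          using finite_has_minimal2[of "{C. vertex_cover ?E C}" D] D(1) by auto
        let ?P = "monomial_ideal {a. 0 < degree_in C a} :: ('v, 'k) mpoly set"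
        have "{r. r * monom (indic (- C)) \<in> ?I} = ?P"
          unfolding colon_monom using colon_minimal_vertex_cover[OF C(2,3)] by simp
        then have "?P \<in> ?Ass" unfolding Ass_iff using primeideal_degree_in_pos by blast
        then have "f \<in> loc_contraction poly_ring ?J ?P" using f L by blast
        then obtain s where s: "s \<notin> ?P" "s * f \<in> ?J"
          unfolding loc_contraction_eq[OF J primeideal_degree_in_pos] by blast
        \<comment> \<open>The cover meets every edge, so the square of the edge ideal lies in the
          square of the prime, which is primary.\<close>
        have edge: "1 \<le> degree_in C a" if "a \<in> edge_exps ?E" for a
          using C(2) that by (fastforce simp: edge_exps_def vertex_cover_def Suc_le_eq degree_in_pos_iff)
        have "edge_pair_exps ?E \<subseteq> {a. 2 \<le> degree_in C a}"
        proof
          fix c assume "c \<in> edge_pair_exps ?E"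
          then obtain a b where "c = a + b" "a \<in> edge_exps ?E" "b \<in> edge_exps ?E"
            unfolding edge_pair_exps_def by blast
          then show "c \<in> {a. 2 \<le> degree_in C a}"
            using edge[of a] edge[of b] by (simp add: degree_in_add)
        qed
        then have "s * f \<in> monomial_ideal {a. 2 \<le> degree_in C a}"
          using s(2) by (auto simp: monomial_ideal_def)
        from degree_in_ge_if_multiple[OF this s(1)] w have "2 \<le> degree_in C w"
          by (auto simp: monomial_ideal_def)
        also have "\<dots> \<le> degree_in D w" by (rule degree_in_mono[OF C(1)])
        finally show False using D(2) by simp
      qed
      then show "f \<in> monomial_ideal ?Q" unfolding monomial_ideal_def by blast
    qed
  qed
qed

section \<open>Both v-numbers as least degrees of monomials\<close>

lemma v_symbolic_defect_2_edge_ideal: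
  fixes G :: "'v::finite ugraph"
  assumes G: "simple_graph G" "vertices G = UNIV"
  shows "v_symbolic_defect 2 (edge_ideal G :: ('v, 'k::field) mpoly set) =
    Inf {enat (degree_in UNIV w) |w. w \<in> edge_pair_exps (edges G) \<union> triangle_exps G \<and>
      (\<exists>C. \<forall>a. a + w \<in> edge_pair_exps (edges G) \<longleftrightarrow> 0 < degree_in C a)}"
proof -
  have E: "\<And>e. e \<in> edges G \<Longrightarrow> card e = 2" using G(1) by (simp add: simple_graph_def)
  have edge_ideal: "edge_ideal G = (monomial_ideal (edge_exps (edges G)) :: ('v, 'k) mpoly set)"
    by (rule edge_ideal_eq) (rule E)
  have "ideal_power poly_ring (edge_ideal G :: ('v, 'k) mpoly set) 2 = monomial_ideal (edge_pair_exps (edges G))"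
    unfolding edge_ideal edge_pair_exps_def
    by (rule ideal_power_2_monomial_ideal[OF absorbing_edge_exps])
  then show ?thesis
    unfolding v_symbolic_defect_def symbolic_square_edge_ideal[OF G]
    by (simp only: v_quotient_monomial_ideal[OF absorbing_edge_pair_exps])
qed

text \<open>The formula also reproduces the convention for graphs without edges: there the exponent
  0 with \<open>C = {}\<close> attains degree 0.\<close>

lemma v_edge_ideal_eq:
  fixes H :: "'v::finite ugraph"
  assumes E: "\<And>e. e \<in> edges H \<Longrightarrow> card e = 2"
  shows "v_edge_ideal TYPE('k::field) H =
    Inf {enat (degree_in UNIV f) |f. \<exists>C. \<forall>a. a + f \<in> edge_exps (edges H) \<longleftrightarrow> 0 < degree_in C a}"
    (is "_ = Inf ?S")
proof (cases "edges H = {}")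
  case True
  have "\<forall>a. a + 0 \<in> edge_exps (edges H) \<longleftrightarrow> 0 < degree_in {} a"
    by (simp add: True edge_exps_def degree_in_def)
  then have "enat (degree_in UNIV (0 :: 'v \<Rightarrow>\<^sub>0 nat)) \<in> ?S" by blast
  then have "0 \<in> ?S" by (simp add: degree_in_def zero_enat_def)
  then have "Inf ?S = 0" using Inf_lower[of 0 ?S] by simp
  then show ?thesis using True by (simp add: v_edge_ideal_def)
next
  case False
  have edge_ideal: "edge_ideal H = (monomial_ideal (edge_exps (edges H)) :: ('v, 'k) mpoly set)"
    by (rule edge_ideal_eq) (rule E)
  have "carrier poly_ring = (monomial_ideal UNIV :: ('v, 'k) mpoly set)"
    by (simp add: monomial_ideal_def)
  then show ?thesis
    using False by (simp add: v_edge_ideal_def v_ideal_def edge_ideal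
      v_quotient_monomial_ideal[OF absorbing_edge_exps] del: poly_ring_simps)
qed

section \<open>Comparison of the two infima\<close>

definition restrict_exps :: "'v::finite set \<Rightarrow> ('v \<Rightarrow>\<^sub>0 nat) \<Rightarrow> ('v \<Rightarrow>\<^sub>0 nat)" where
  "restrict_exps S a = (\<Sum>v\<in>S. Poly_Mapping.single v (lookup a v))"

lemma lookup_restrict_exps: "lookup (restrict_exps S a) v = (if v \<in> S then lookup a v else 0)"
  by (simp add: restrict_exps_def lookup_sum lookup_single when_def)

lemma degree_in_restrict_exps_le: "degree_in UNIV (restrict_exps S a) \<le> degree_in UNIV a"
  unfolding degree_in_def by (intro sum_mono) (simp add: lookup_restrict_exps)

lemma Inf_enat_mem: "A \<noteq> {} \<Longrightarrow> Inf A \<in> A" for A :: "enat set"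
  unfolding Inf_enat_def by (auto intro: LeastI)

theorem theorem4p2:
  fixes G :: "'v::finite ugraph"
  assumes "simple_graph G" and "vertices G = UNIV"
  shows "v_symbolic_defect 2 (edge_ideal G :: ('v, 'k::field) mpoly set) =
    (INF T\<in>{T. is_triangle G T}.
       3 + v_edge_ideal TYPE('k) (delete_vertices G (closed_nbhd G T)))"
proof -
  let ?N = "closed_nbhd G"
  let ?Q = "\<lambda>T. edge_exps (edges (delete_vertices G (?N T)))"
  let ?S = "{enat (degree_in UNIV w) |w. w \<in> edge_pair_exps (edges G) \<union> triangle_exps G \<and>
      (\<exists>C. \<forall>a. a + w \<in> edge_pair_exps (edges G) \<longleftrightarrow> 0 < degree_in C a)}"
  let ?R = "\<lambda>T. {enat (degree_in UNIV f) |f. \<exists>C. \<forall>a. a + f \<in> ?Q T \<longleftrightarrow> 0 < degree_in C a}"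
  have v: "v_edge_ideal TYPE('k) (delete_vertices G (?N T)) = Inf (?R T)" for T
    using assms(1) by (intro v_edge_ideal_eq) (auto simp: delete_vertices_def simple_graph_def)
  have Q_cong: "a \<in> ?Q T \<longleftrightarrow> b \<in> ?Q T" if "\<And>v. v \<notin> ?N T \<Longrightarrow> lookup a v = lookup b v" for a b T
  proof -
    have "(\<forall>v\<in>e. 0 < lookup a v) \<longleftrightarrow> (\<forall>v\<in>e. 0 < lookup b v)" if "e \<in> edges (delete_vertices G (?N T))" for e
      using that \<open>\<And>v. v \<notin> ?N T \<Longrightarrow> lookup a v = lookup b v\<close>
      by (auto simp: delete_vertices_def subset_iff)
    then show ?thesis unfolding edge_exps_def by blast
  qed
  have degree: "degree_in UNIV (indic T + f) = 3 + degree_in UNIV f" if "is_triangle G T" for T f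
    using that by (simp add: degree_in_add degree_in_indic is_triangle_def)
  note colon = edge_square_colon_triangle[OF assms]
  show ?thesis
    unfolding v_symbolic_defect_2_edge_ideal[OF assms] v
  proof (rule antisym)
    show "Inf ?S \<le> (INF T\<in>{T. is_triangle G T}. 3 + Inf (?R T))"
    proof (rule INF_greatest)
      fix T assume "T \<in> {T. is_triangle G T}"
      then have T: "is_triangle G T" by simp
      show "Inf ?S \<le> 3 + Inf (?R T)"
      proof (cases "?R T = {}")
        case False
        then have "Inf (?R T) \<in> ?R T" by (rule Inf_enat_mem)
        then obtain f C where f: "Inf (?R T) = enat (degree_in UNIV f)"
          and C: "\<And>a. a + f \<in> ?Q T \<longleftrightarrow> 0 < degree_in C a" by blast
        \<comment> \<open>An optimal \<open>f\<close> might involve variables of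
          \<open>N[T]\<close>, which would put \<open>x_T f\<close> into the square. Removing them
          leaves the colon ideal in \<open>G - N[T]\<close> unchanged and does not raise the
          degree.\<close>
        define f' where "f' = restrict_exps (- ?N T) f"
        have "a + (indic T + f') \<in> edge_pair_exps (edges G) \<longleftrightarrow> 0 < degree_in (?N T \<union> C) a" for a
        proof -
          have "a + f' \<in> ?Q T \<longleftrightarrow> a + f \<in> ?Q T"
            by (rule Q_cong) (simp add: f'_def lookup_add lookup_restrict_exps)
          moreover have "0 < degree_in (?N T) (a + f') \<longleftrightarrow> 0 < degree_in (?N T) a"
            by (simp add: degree_in_pos_iff f'_def lookup_add lookup_restrict_exps)
          ultimately show ?thesis
            using colon[OF T, of "a + f'"] C[of a]
            by (simp add: degree_in_pos_iff bex_Un ac_simps)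
        qed
        moreover have "indic T + f' \<in> triangle_exps G"
          using T by (auto simp: triangle_exps_def lookup_add lookup_indic)
        ultimately have "enat (degree_in UNIV (indic T + f')) \<in> ?S" by blast
        then have "Inf ?S \<le> enat (degree_in UNIV (indic T + f'))" by (rule Inf_lower)
        also have "\<dots> \<le> enat (3 + degree_in UNIV f)"
          using degree_in_restrict_exps_le[of "- ?N T" f] by (simp add: degree[OF T] f'_def)
        also have "\<dots> = 3 + Inf (?R T)" by (simp add: f numeral_eq_enat)
        finally show ?thesis .
      next
        case True
        \<comment> \<open>Without any admissible \<open>f\<close> the right-hand side is
          infinite.\<close>
        then show ?thesis by (simp only: Inf_empty) (simp add: top_enat_def)
      qed
    qed
    show "(INF T\<in>{T. is_triangle G T}. 3 + Inf (?R T)) \<le> Inf ?S"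
    proof (rule Inf_greatest)
      fix x assume "x \<in> ?S"
      then obtain w C where x: "x = enat (degree_in UNIV w)"
        and w: "w \<in> edge_pair_exps (edges G) \<union> triangle_exps G"
        and C: "\<And>a. a + w \<in> edge_pair_exps (edges G) \<longleftrightarrow> 0 < degree_in C a" by blast
      \<comment> \<open>At \<open>a = 0\<close> the colon ideal is seen to be proper, so
        \<open>w\<close> must be a multiple of a triangle monomial.\<close>
      have not0: "w \<notin> edge_pair_exps (edges G)" using C[of 0] by (simp add: degree_in_def)
      with w obtain T where T: "is_triangle G T" "\<And>v. v \<in> T \<Longrightarrow> 0 < lookup w v"
        by (auto simp: triangle_exps_def)
      define f where "f = w - indic T"
      have wf: "w = indic T + f" unfolding f_def by (rule eq_indic_plus[OF T(2)])
      have iff: "0 < degree_in C a \<longleftrightarrow> 0 < degree_in (?N T) (a + f) \<or> a + f \<in> ?Q T" for a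
        using C[of a] colon[OF T(1), of "a + f"] by (simp add: wf ac_simps)
      \<comment> \<open>Again from \<open>a = 0\<close>: a variable of \<open>N[T]\<close> in
        \<open>f\<close> would make the colon ideal the whole ring.\<close>
      have f0: "degree_in (?N T) f = 0" using iff[of 0] by (simp add: degree_in_def)
      then have iff: "0 < degree_in C a \<longleftrightarrow> 0 < degree_in (?N T) a \<or> a + f \<in> ?Q T" for a
        using iff[of a] by (simp add: degree_in_add)
      \<comment> \<open>The colon ideal in \<open>G - N[T]\<close> is generated by the variables of
        \<open>C\<close> outside \<open>N[T]\<close>. One direction strips \<open>a\<close> of
        \<open>N[T]\<close>; the other tests \<open>iff\<close> on a single variable.\<close>
      have "a + f \<in> ?Q T \<longleftrightarrow> 0 < degree_in (C - ?N T) a" for a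
      proof
        assume "a + f \<in> ?Q T"
        moreover have "restrict_exps (- ?N T) a + f \<in> ?Q T \<longleftrightarrow> a + f \<in> ?Q T"
          by (rule Q_cong) (simp add: lookup_add lookup_restrict_exps)
        ultimately have "0 < degree_in C (restrict_exps (- ?N T) a)" using iff by blast
        then show "0 < degree_in (C - ?N T) a"
          by (auto simp: degree_in_pos_iff lookup_restrict_exps split: if_splits)
      next
        assume "0 < degree_in (C - ?N T) a"
        then obtain v where v: "v \<in> C" "v \<notin> ?N T" "0 < lookup a v" by (auto simp: degree_in_pos_iff)
        obtain b where b: "a = var v + b" using var_factor[OF v(3)] by blast
        have "0 < degree_in C (var v)" using v(1) by (auto simp: degree_in_pos_iff intro!: bexI[of _ v])
        moreover have "degree_in (?N T) (var v) = 0"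
          using v(2) by (auto simp: degree_in_eq_0_iff lookup_single when_def)
        ultimately have "var v + f \<in> ?Q T" using iff[of "var v"] by simp
        from absorbingD[OF absorbing_edge_exps this, of b] show "a + f \<in> ?Q T"
          by (simp add: b ac_simps)
      qed
      then have "enat (degree_in UNIV f) \<in> ?R T" by blast
      then have "3 + Inf (?R T) \<le> 3 + enat (degree_in UNIV f)"
        by (intro add_left_mono Inf_lower)
      also have "\<dots> = x" by (simp add: x wf degree[OF T(1)] numeral_eq_enat)
      finally show "(INF T\<in>{T. is_triangle G T}. 3 + Inf (?R T)) \<le> x"
        using T(1) by (intro INF_lower2[of T]) auto
    qed
  qed
qed

end
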